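(* Let $P$ be a level Eulerian poset with underlying digraph on the vertex set $V$, and let $x,y\in V$. Then the $\mathbf{a}\mathbf{b}$-series $\Psi_{x,y}$ of $P$ is a rational generating function in the non-commutative variables $\mathbf{c}=\mathbf{a}+\mathbf{b}$ and $\mathbf{d}=\mathbf{a}\mathbf{b}+\mathbf{b}\mathbf{a}$; that is, there is a rational non-commutative formal power series $\Phi$ in two variables such that $\Psi_{x,y}=\Phi(\mathbf{a}+\mathbf{b},\,\mathbf{a}\mathbf{b}+\mathbf{b}\mathbf{a})$.
   Context: Level poset: let $M$ be a $0/1$ square matrix with rows and columns indexed by a finite nonempty set $V$. The level poset of $M$ is the poset on $V\times\mathbb{Z}$ with $(u,i)<(v,j)$ if and only if $i<j$ and $(M^{j-i})_{u,v}>0$; the second coordinate is its rank function. A finite graded poset (with minimum, maximum and rank function $\rho$) is Eulerian if every interval $[x,y]$ in it of rank at least $1$ satisfies $\sum_{x\le z\le y}(-1)^{\rho(z)}=0$. A level poset is level Eulerian if every one of its intervals is Eulerian. $\mathbf{a}\mathbf{b}$-index: for a finite graded poset $Q$ of rank $m+1$ with minimum $\hat0$, maximum $\hat1$ and rank function $\rho$, and a chain $c=\{\hat0=x_0<x_1<\cdots<x_{k+1}=\hat1\}$, put $$\operatorname{wt}(c)=(\mathbf{a}-\mathbf{b})^{\rho(x_0,x_1)-1}\cdot\mathbf{b}\cdot(\mathbf{a}-\mathbf{b})^{\rho(x_1,x_2)-1}\cdot\mathbf{b}\cdots\mathbf{b}\cdot(\mathbf{a}-\mathbf{b})^{\rho(x_k,x_{k+1})-1},$$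 where $\rho(x,y)=\rho(y)-\rho(x)$ and $\mathbf{a},\mathbf{b}$ are non-commuting variables of degree one. Then $\Psi(Q)=\sum_c\operatorname{wt}(c)$, summed over all chains $c$ containing $\hat0$ and $\hat1$; it is homogeneous of degree $m$. $\mathbf{a}\mathbf{b}$-series: $\Psi_{x,y}=\sum_{m\ge0}\Psi([(x,0),(y,m+1)])\in\mathbb{R}\langle\langle\mathbf{a},\mathbf{b}\rangle\rangle$, where $\Psi([(x,0),(y,m+1)])$ is taken to be $0$ if $(x,0)\not\le(y,m+1)$. A non-commutative formal power series is rational if it belongs to the smallest set of series containing all non-commutative polynomials and closed under sums, products, and inverses of series with nonzero constant term. *)

theory Defs
  imports "HOL-Analysis.Analysis"
begin

section \<open>Non-commutative formal power series\<close>

typedef 'x ncseries = "UNIV :: ('x list \<Rightarrow> real) set"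
  morphisms nc_coeff Abs_ncseries ..

setup_lifting type_definition_ncseries

instantiation ncseries :: (type) ring_1
begin

lift_definition zero_ncseries :: "'x ncseries" is "\<lambda>w. 0" .

lift_definition one_ncseries :: "'x ncseries" is "\<lambda>w. if w = [] then 1 else 0" .

lift_definition plus_ncseries :: "'x ncseries \<Rightarrow> 'x ncseries \<Rightarrow> 'x ncseries"
  is "\<lambda>f g w. f w + g w" .

lift_definition uminus_ncseries :: "'x ncseries \<Rightarrow> 'x ncseries" is "\<lambda>f w. - f w" .

lift_definition minus_ncseries :: "'x ncseries \<Rightarrow> 'x ncseries \<Rightarrow> 'x ncseries"
  is "\<lambda>f g w. f w - g w" .

lift_definition times_ncseries :: "'x ncseries \<Rightarrow> 'x ncseries \<Rightarrow> 'x ncseries"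
  is "\<lambda>f g w. \<Sum>i\<le>length w. f (take i w) * g (drop i w)" .

instance
proof
  fix f g h :: "'x ncseries"
  show "f * g * h = f * (g * h)"
  proof (transfer, rule ext)
    fix f g h :: "'x list \<Rightarrow> real" and w :: "'x list"
    let ?n = "length w"
    have "(\<Sum>i\<le>?n. (\<Sum>j\<le>length (take i w). f (take j (take i w)) * g (drop j (take i w))) * h (drop i w))
        = (\<Sum>i\<le>?n. \<Sum>j\<le>i. f (take j w) * g (drop j (take i w)) * h (drop i w))"
      by (auto intro!: sum.cong simp: sum_distrib_right min_absorb1 min_absorb2)
    also have "\<dots> = (\<Sum>(i,j)\<in>(SIGMA i:{..?n}. {..i}). f (take j w) * g (drop j (take i w)) * h (drop i w))"
      by (simp add: sum.Sigma)
    also have "\<dots> = (\<Sum>(j,k)\<in>(SIGMA j:{..?n}. {..?n - j}). f (take j w) * g (take k (drop j w)) * h (drop (k + j) w))"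
      by (rule sum.reindex_bij_witness[where i = "\<lambda>(j,k). (j + k, j)" and j = "\<lambda>(i,j). (j, i - j)"])
         (auto simp: drop_take add.commute)
    also have "\<dots> = (\<Sum>j\<le>?n. \<Sum>k\<le>?n - j. f (take j w) * g (take k (drop j w)) * h (drop (k + j) w))"
      by (simp add: sum.Sigma)
    also have "\<dots> = (\<Sum>j\<le>?n. f (take j w) * (\<Sum>k\<le>length (drop j w). g (take k (drop j w)) * h (drop k (drop j w))))"
      by (simp add: sum_distrib_left mult.assoc)
    finally show "(\<Sum>i\<le>?n. (\<Sum>j\<le>length (take i w). f (take j (take i w)) * g (drop j (take i w))) * h (drop i w))
        = (\<Sum>j\<le>?n. f (take j w) * (\<Sum>k\<le>length (drop j w). g (take k (drop j w)) * h (drop k (drop j w))))" .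
  qed
  show "1 * f = f"
  proof (transfer, rule ext)
    fix f :: "'x list \<Rightarrow> real" and w :: "'x list"
    have "(\<Sum>i\<le>length w. (if take i w = [] then 1 else 0) * f (drop i w))
        = (\<Sum>i\<le>length w. if i = 0 then f (drop i w) else 0)"
      by (rule sum.cong) auto
    then show "(\<Sum>i\<le>length w. (if take i w = [] then 1 else 0) * f (drop i w)) = f w"
      by simp
  qed
  show "f * 1 = f"
  proof (transfer, rule ext)
    fix f :: "'x list \<Rightarrow> real" and w :: "'x list"
    have "(\<Sum>i\<le>length w. f (take i w) * (if drop i w = [] then 1 else 0))
        = (\<Sum>i\<le>length w. if i = length w then f (take i w) else 0)"
      by (rule sum.cong) auto
    then show "(\<Sum>i\<le>length w. f (take i w) * (if drop i w = [] then 1 else 0)) = f w"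
      by simp
  qed
  show "(f + g) * h = f * h + g * h"
    by transfer (simp add: distrib_right sum.distrib)
  show "f * (g + h) = f * g + f * h"
    by transfer (simp add: distrib_left sum.distrib)
  show "f + g + h = f + (g + h)" by transfer (simp add: add.assoc)
  show "f + g = g + f" by transfer (simp add: add.commute)
  show "0 + f = f" by transfer simp
  show "- f + f = 0" by transfer simp
  show "f - g = f + - g" by transfer simp
  show "(0 :: 'x ncseries) \<noteq> 1" by transfer (metis zero_neq_one)
qed

end

lift_definition nc_var :: "'x \<Rightarrow> 'x ncseries" is "\<lambda>x w. if w = [x] then 1 else 0" .

inductive_set nc_rational :: "'x ncseries set" where
  polynomial: "finite {w. nc_coeff p w \<noteq> 0} \<Longrightarrow> p \<in> nc_rational"
| add: "f \<in> nc_rational \<Longrightarrow> g \<in> nc_rational \<Longrightarrow> f + g \<in> nc_rational"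
| mult: "f \<in> nc_rational \<Longrightarrow> g \<in> nc_rational \<Longrightarrow> f * g \<in> nc_rational"
| inverse: "f \<in> nc_rational \<Longrightarrow> nc_coeff f [] \<noteq> 0 \<Longrightarrow> f * g = 1 \<Longrightarrow> g * f = 1 \<Longrightarrow> g \<in> nc_rational"

text \<open>
  Substitution of the series \<open>\<sigma> x\<close> for the variables \<open>x\<close>. It is meaningful when all \<open>\<sigma> x\<close> have
  zero constant term: then the image of a word \<open>v\<close> has no terms of degree less than \<open>length v\<close>,
  so that only the words \<open>v\<close> listed below contribute to the coefficient of \<open>w\<close>.
\<close>

definition nc_subst :: "('y::finite \<Rightarrow> 'x ncseries) \<Rightarrow> 'y ncseries \<Rightarrow> 'x ncseries" where
  "nc_subst \<sigma> \<Phi> =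
    Abs_ncseries (\<lambda>w. \<Sum>v | length v \<le> length w. nc_coeff \<Phi> v * nc_coeff (prod_list (map \<sigma> v)) w)"


section \<open>Finite graded posets, Eulerian posets, and the ab-index\<close>

text \<open>
  Rank functions are integer-valued and not normalised to \<open>0\<close> at the minimum, so that a rank
  function on a poset restricts to its intervals; the notions below are invariant under adding a
  constant to \<open>\<rho>\<close>.
\<close>

definition finite_graded_poset :: "'p set \<Rightarrow> ('p \<Rightarrow> 'p \<Rightarrow> bool) \<Rightarrow> ('p \<Rightarrow> int) \<Rightarrow> bool" where
  "finite_graded_poset Q le \<rho> \<longleftrightarrow>
     finite Q \<and> partial_order_on Q (relation_of le Q) \<and>
     (\<exists>z\<in>Q. \<forall>x\<in>Q. le z x) \<and> (\<exists>z\<in>Q. \<forall>x\<in>Q. le x z) \<and>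
     (\<forall>x\<in>Q. \<forall>y\<in>Q. le x y \<and> x \<noteq> y \<and> (\<forall>z\<in>Q. le x z \<and> le z y \<longrightarrow> z = x \<or> z = y)
        \<longrightarrow> \<rho> y = \<rho> x + 1)"

definition eulerian :: "'p set \<Rightarrow> ('p \<Rightarrow> 'p \<Rightarrow> bool) \<Rightarrow> ('p \<Rightarrow> int) \<Rightarrow> bool" where
  "eulerian Q le \<rho> \<longleftrightarrow> finite_graded_poset Q le \<rho> \<and>
     (\<forall>x\<in>Q. \<forall>y\<in>Q. le x y \<and> \<rho> y - \<rho> x \<ge> 1 \<longrightarrow>
        (\<Sum>z | z \<in> Q \<and> le x z \<and> le z y. (-1 :: real) powi \<rho> z) = 0)"

datatype ab = Va | Vb

fun chain_wt :: "('p \<Rightarrow> int) \<Rightarrow> 'p list \<Rightarrow> ab ncseries" where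
  "chain_wt \<rho> (x # y # z # c) =
     (nc_var Va - nc_var Vb) ^ nat (\<rho> y - \<rho> x - 1) * nc_var Vb * chain_wt \<rho> (y # z # c)"
| "chain_wt \<rho> [x, y] = (nc_var Va - nc_var Vb) ^ nat (\<rho> y - \<rho> x - 1)"
| "chain_wt \<rho> [x] = 1"
| "chain_wt \<rho> [] = 1"

text \<open>A chain is represented by the strictly increasing list of its elements.\<close>

definition full_chains :: "'p set \<Rightarrow> ('p \<Rightarrow> 'p \<Rightarrow> bool) \<Rightarrow> 'p list set" where
  "full_chains Q le = {c. c \<noteq> [] \<and> set c \<subseteq> Q \<and> sorted_wrt (\<lambda>x y. le x y \<and> x \<noteq> y) c \<and>
     (\<forall>z\<in>Q. le (hd c) z) \<and> (\<forall>z\<in>Q. le z (last c))}"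

text \<open>
  Only meaningful for posets of rank at least \<open>1\<close>; the equations for lists of length below \<open>2\<close>
  in \<^const>\<open>chain_wt\<close> are then irrelevant.
\<close>

definition ab_index :: "'p set \<Rightarrow> ('p \<Rightarrow> 'p \<Rightarrow> bool) \<Rightarrow> ('p \<Rightarrow> int) \<Rightarrow> ab ncseries" where
  "ab_index Q le \<rho> = (\<Sum>c\<in>full_chains Q le. chain_wt \<rho> c)"


section \<open>Level posets\<close>

definition zero_one_matrix :: "real^'v^'v \<Rightarrow> bool" where
  "zero_one_matrix M \<longleftrightarrow> (\<forall>u v. M $ u $ v \<in> {0, 1})"

text \<open>The library's \<open>M ^ k\<close> on this type is the entrywise power.\<close>

primrec matrix_power :: "real^'v^'v \<Rightarrow> nat \<Rightarrow> real^'v^'v" where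
  "matrix_power M 0 = mat 1"
| "matrix_power M (Suc k) = M ** matrix_power M k"

definition level_less :: "real^'v^'v \<Rightarrow> 'v \<times> int \<Rightarrow> 'v \<times> int \<Rightarrow> bool" where
  "level_less M p q \<longleftrightarrow> snd p < snd q \<and> matrix_power M (nat (snd q - snd p)) $ fst p $ fst q > 0"

definition level_le :: "real^'v^'v \<Rightarrow> 'v \<times> int \<Rightarrow> 'v \<times> int \<Rightarrow> bool" where
  "level_le M p q \<longleftrightarrow> p = q \<or> level_less M p q"

definition level_interval :: "real^'v^'v \<Rightarrow> 'v \<times> int \<Rightarrow> 'v \<times> int \<Rightarrow> ('v \<times> int) set" where
  "level_interval M p q = {z. level_le M p z \<and> level_le M z q}"

definition level_eulerian :: "real^'v^'v \<Rightarrow> bool" where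
  "level_eulerian M \<longleftrightarrow>
     (\<forall>p q. level_le M p q \<longrightarrow> eulerian (level_interval M p q) (level_le M) snd)"

definition level_ab_index :: "real^'v^'v \<Rightarrow> 'v \<Rightarrow> 'v \<Rightarrow> nat \<Rightarrow> ab ncseries" where
  "level_ab_index M x y m =
     (if level_le M (x, 0) (y, int m + 1)
      then ab_index (level_interval M (x, 0) (y, int m + 1)) (level_le M) snd
      else 0)"

text \<open>
  The sum over \<open>m\<close> is taken coefficientwise; each coefficient is a sum with at most one nonzero
  term because the summands are homogeneous of degree \<open>m\<close>.
\<close>

definition ab_series :: "real^'v^'v \<Rightarrow> 'v \<Rightarrow> 'v \<Rightarrow> ab ncseries" where
  "ab_series M x y = Abs_ncseries (\<lambda>w. \<Sum>m. nc_coeff (level_ab_index M x y m) w)"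

datatype cd = Vc | Vd

instance cd :: finite
proof
  have "(UNIV :: cd set) = {Vc, Vd}"
    using cd.exhaust by blast
  then show "finite (UNIV :: cd set)"
    by (metis finite.emptyI finite.insertI)
qed

fun cd_to_ab :: "cd \<Rightarrow> ab ncseries" where
  "cd_to_ab Vc = nc_var Va + nc_var Vb"
| "cd_to_ab Vd = nc_var Va * nc_var Vb + nc_var Vb * nc_var Va"


text \<open>
  Intervals of a level poset are finite graded posets with rank function the second coordinate,
  so \<^const>\<open>level_eulerian\<close> only restricts the alternating sums.
\<close>

lemma matrix_power_add: "matrix_power M (j + k) = matrix_power M j ** matrix_power M k"
  by (induction j) (simp_all add: matrix_mul_assoc)

lemma matrix_power_nonneg:
  assumes "zero_one_matrix M" shows "matrix_power M k $ u $ v \<ge> 0"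
proof (induction k arbitrary: u v)
  case 0
  show ?case by (simp add: mat_def)
next
  case (Suc k)
  have "M $ u $ t \<ge> 0" for t
    using assms unfolding zero_one_matrix_def by (metis empty_iff insert_iff order_refl zero_le_one)
  then show ?case using Suc by (auto simp: matrix_matrix_mult_def intro!: sum_nonneg)
qed

lemma matrix_power_add_pos_iff:
  assumes "zero_one_matrix M"
  shows "matrix_power M (j + k) $ u $ v > 0 \<longleftrightarrow>
    (\<exists>t. matrix_power M j $ u $ t > 0 \<and> matrix_power M k $ t $ v > 0)"
proof -
  note nn = matrix_power_nonneg[OF assms]
  have eq: "matrix_power M (j + k) $ u $ v = (\<Sum>t\<in>UNIV. matrix_power M j $ u $ t * matrix_power M k $ t $ v)"
    by (simp add: matrix_power_add matrix_matrix_mult_def)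
  have "(\<Sum>t\<in>UNIV. matrix_power M j $ u $ t * matrix_power M k $ t $ v) = 0 \<longleftrightarrow>
    (\<forall>t. matrix_power M j $ u $ t * matrix_power M k $ t $ v = 0)"
    by (subst sum_nonneg_eq_0_iff) (auto simp: nn)
  moreover have "(\<Sum>t\<in>UNIV. matrix_power M j $ u $ t * matrix_power M k $ t $ v) \<ge> 0"
    by (simp add: nn sum_nonneg)
  moreover have "r > 0 \<longleftrightarrow> r \<noteq> 0" if "r \<ge> 0" for r :: real
    using that by auto
  ultimately show ?thesis
    unfolding eq by (simp add: nn)
qed

lemma level_less_trans:
  assumes "zero_one_matrix M" "level_less M p q" "level_less M q r"
  shows "level_less M p r"
proof -
  have "nat (snd r - snd p) = nat (snd q - snd p) + nat (snd r - snd q)"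
    using assms(2,3) by (auto simp: level_less_def simp flip: nat_add_distrib)
  then show ?thesis
    using assms matrix_power_add_pos_iff[OF assms(1)] by (auto simp: level_less_def)
qed

lemma finite_level_interval: "finite (level_interval M p q)"
proof (rule finite_subset)
  show "level_interval M p q \<subseteq> UNIV \<times> {snd p..snd q}"
    by (auto simp: level_interval_def level_le_def level_less_def)
qed simp

lemma finite_graded_poset_level_interval:
  assumes M: "zero_one_matrix M" and pq: "level_le M p q"
  shows "finite_graded_poset (level_interval M p q) (level_le M) snd"
  unfolding finite_graded_poset_def
proof (intro conjI)
  show "finite (level_interval M p q)" by (rule finite_level_interval)
  have tr: "level_le M a c" if "level_le M a b" "level_le M b c" for a b c
    using that level_less_trans[OF M] unfolding level_le_def by blast
  show "partial_order_on (level_interval M p q) (relation_of (level_le M) (level_interval M p q))"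
  proof (rule partial_order_on_relation_ofI)
    show "level_le M a a" for a by (simp add: level_le_def)
    show "level_le M a c" if "level_le M a b" "level_le M b c" for a b c
      using that by (rule tr)
    show "a = b" if "level_le M a b" "level_le M b a" for a b
      using that by (auto simp: level_le_def level_less_def)
  qed
  have "p \<in> level_interval M p q" "q \<in> level_interval M p q"
    using pq by (simp_all add: level_interval_def) (simp_all add: level_le_def)
  then show "\<exists>z\<in>level_interval M p q. \<forall>x\<in>level_interval M p q. level_le M z x"
    "\<exists>z\<in>level_interval M p q. \<forall>x\<in>level_interval M p q. level_le M x z"
    unfolding level_interval_def by blast+
  show "\<forall>x\<in>level_interval M p q. \<forall>y\<in>level_interval M p q.
     level_le M x y \<and> x \<noteq> y \<and> (\<forall>z\<in>level_interval M p q. level_le M x z \<and> level_le M z y \<longrightarrow> z = x \<or> z = y)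
     \<longrightarrow> snd y = snd x + 1"
  proof (intro ballI impI, rule ccontr)
    fix x y
    assume x: "x \<in> level_interval M p q" and y: "y \<in> level_interval M p q"
      and c: "level_le M x y \<and> x \<noteq> y \<and> (\<forall>z\<in>level_interval M p q. level_le M x z \<and> level_le M z y \<longrightarrow> z = x \<or> z = y)"
      and ne: "snd y \<noteq> snd x + 1"
    from c have xy: "level_less M x y" unfolding level_le_def by blast
    then have "nat (snd y - snd x) = 1 + nat (snd y - (snd x + 1))" and lt: "snd x + 1 < snd y"
      using ne by (auto simp: level_less_def)
    then obtain t where t: "matrix_power M 1 $ fst x $ t > 0"
      "matrix_power M (nat (snd y - (snd x + 1))) $ t $ fst y > 0"
      using xy matrix_power_add_pos_iff[OF M, of 1 "nat (snd y - (snd x + 1))" "fst x" "fst y"]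
      by (auto simp: level_less_def)
    let ?z = "(t, snd x + 1)"
    have "level_less M x ?z" "level_less M ?z y"
      using lt t by (simp_all add: level_less_def)
    then have z: "level_le M x ?z" "level_le M ?z y"
      by (simp_all add: level_le_def)
    have "level_le M p x" "level_le M y q"
      using x y by (simp_all add: level_interval_def)
    then have "?z \<in> level_interval M p q"
      using tr[OF _ z(1)] tr[OF z(2)] by (simp add: level_interval_def)
    then have "?z = x \<or> ?z = y"
      using c z by blast
    then have "snd ?z = snd x \<or> snd ?z = snd y"
      by metis
    then show False
      using lt by simp
  qed
qed

end

(*
  Let K(t) = K0(t^2) + t K1(t^2) be the matrix whose (u,v) entry is the sum of t^(k-1) over those
  k >= 1 for which v is reachable from u in k steps. Splitting off the last step of a chain gives
  Psi = K + Psi b K at t = a - b. The Euler relations say K(t) - K(-t) = t K(t) K(-t), that is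
  K(t) (1 - t K(-t) / 2) = K0(t^2). Multiplying the recurrence by 1 - t K(-t) / 2 and using
  b + t/2 = c/2 therefore turns it into Psi = K0(s) + Psi (c K0(s) - s K1(s)) / 2, where
  s = t^2 = c^2 - 2d. The reachability relations are eventually periodic in the number of steps,
  so K0(s) and K1(s) are rational in c and d, and so is the unique solution of this proper linear
  system.
*)

theory Submission
  imports Defs
begin

section \<open>Coefficients of non-commutative series\<close>

text \<open>The obstacle is that neither t = a - b nor b is a series in c and d; only the square of
  t is. So the recurrence Psi = K + Psi b K cannot be lifted to c and d term by term. The multiplier
  1 - t K(-t) / 2 removes both defects at once: it replaces K by its even part, the average of K(t)
  and K(-t), and the correction Psi t K(-t) / 2 that it creates supplies the t / 2 that completes b
  to c / 2, while the rest of it, -s K1(s) / 2, involves s alone. With x fixed, Psi is a row vector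
  indexed by the end vertex, hence all coefficient matrices act from the right. It is never shown
  directly that Psi is the image of a series in c and d. The system is first solved by rational
  series in two abstract variables; the image of that solution must be Psi, because a system whose
  coefficients have zero constant term has only one solution. The identities for K are proved for
  power series in a commuting variable and carried to t by evaluation.\<close>

lemma ncseries_eqI: "(\<And>w. nc_coeff f w = nc_coeff g w) \<Longrightarrow> f = g"
  by (metis ext nc_coeff_inject)

lemma nc_coeff_Abs [simp]: "nc_coeff (Abs_ncseries f) = f"
  by (simp add: Abs_ncseries_inverse)

lemma nc_coeff_0 [simp]: "nc_coeff 0 w = 0"
  by (simp add: zero_ncseries.rep_eq)

lemma nc_coeff_1: "nc_coeff 1 w = (if w = [] then 1 else 0)"
  by (simp add: one_ncseries.rep_eq)

lemma nc_coeff_add [simp]: "nc_coeff (f + g) w = nc_coeff f w + nc_coeff g w"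
  by (simp add: plus_ncseries.rep_eq)

lemma nc_coeff_diff [simp]: "nc_coeff (f - g) w = nc_coeff f w - nc_coeff g w"
  by (simp add: minus_ncseries.rep_eq)

lemma nc_coeff_mult:
  "nc_coeff (f * g) w = (\<Sum>i\<le>length w. nc_coeff f (take i w) * nc_coeff g (drop i w))"
  by (simp add: times_ncseries.rep_eq)

lemma nc_coeff_sum [simp]: "nc_coeff (\<Sum>i\<in>A. f i) w = (\<Sum>i\<in>A. nc_coeff (f i) w)"
  by (induction A rule: infinite_finite_induct) simp_all

lemma nc_coeff_var: "nc_coeff (nc_var x) w = (if w = [x] then 1 else 0)"
  by (simp add: nc_var.rep_eq)

text \<open>Scalars act as constant factors on the left, so that substitution and rationality treat
  them like any other factor.\<close>

lift_definition nc_const :: "real \<Rightarrow> 'x ncseries" is "\<lambda>c w. if w = [] then c else 0" .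

lemma nc_coeff_const: "nc_coeff (nc_const c) w = (if w = [] then c else 0)"
  by (simp add: nc_const.rep_eq)

lemma nc_coeff_const_mult [simp]: "nc_coeff (nc_const c * f) w = c * nc_coeff f w"
proof -
  have "nc_coeff (nc_const c * f) w = (\<Sum>i\<le>length w. if i = 0 then c * nc_coeff f (drop i w) else 0)"
    unfolding nc_coeff_mult by (rule sum.cong) (auto simp: nc_coeff_const)
  then show ?thesis by simp
qed

lemma nc_const_0 [simp]: "nc_const 0 = 0"
  and nc_const_1 [simp]: "nc_const 1 = 1"
  by (rule ncseries_eqI; simp add: nc_coeff_const nc_coeff_1)+

text \<open>The degree filtration stands in for a topology: terms of degree above
  \<open>length w\<close> cannot reach the coefficient of \<open>w\<close>, so infinite sums are cut
  off at a finite stage.\<close>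

definition nc_subdegree_ge :: "nat \<Rightarrow> 'x ncseries \<Rightarrow> bool" where
  "nc_subdegree_ge n f \<longleftrightarrow> (\<forall>w. length w < n \<longrightarrow> nc_coeff f w = 0)"

definition nc_homogeneous :: "nat \<Rightarrow> 'x ncseries \<Rightarrow> bool" where
  "nc_homogeneous n f \<longleftrightarrow> (\<forall>w. length w \<noteq> n \<longrightarrow> nc_coeff f w = 0)"

lemma nc_subdegree_ge_0 [simp]: "nc_subdegree_ge 0 f"
  by (simp add: nc_subdegree_ge_def)

lemma nc_subdegree_ge_1_iff: "nc_subdegree_ge (Suc 0) f \<longleftrightarrow> nc_coeff f [] = 0"
  by (simp add: nc_subdegree_ge_def)

lemma nc_subdegree_ge_mult:
  assumes "nc_subdegree_ge m f" "nc_subdegree_ge n g"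
  shows "nc_subdegree_ge (m + n) (f * g)"
  unfolding nc_subdegree_ge_def nc_coeff_mult
proof (intro allI impI sum.neutral ballI)
  fix w :: "'a list" and i
  assume "length w < m + n" "i \<in> {..length w}"
  then have "length (take i w) < m \<or> length (drop i w) < n" by auto
  then show "nc_coeff f (take i w) * nc_coeff g (drop i w) = 0"
    using assms unfolding nc_subdegree_ge_def by fastforce
qed

lemma nc_subdegree_ge_power:
  "nc_coeff s [] = 0 \<Longrightarrow> nc_subdegree_ge k (s ^ k)"
  using nc_subdegree_ge_mult[of 1 s] by (induction k) (auto simp: nc_subdegree_ge_1_iff)

lemma nc_coeff_prod_list_eq_0:
  assumes "\<And>x. nc_coeff (\<sigma> x) [] = 0" "length w < length v"
  shows "nc_coeff (prod_list (map \<sigma> v)) w = 0"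
proof -
  have "nc_subdegree_ge (length v) (prod_list (map \<sigma> v))"
    by (induction v)
      (use nc_subdegree_ge_mult[of 1] assms(1) in \<open>auto simp: nc_subdegree_ge_1_iff\<close>)
  then show ?thesis using assms(2) by (simp add: nc_subdegree_ge_def)
qed

text \<open>Among the factorisations of \<open>w\<close>, only the one with a prefix of length
  \<open>n\<close> can meet the support of \<open>f\<close>.\<close>

lemma nc_coeff_homogeneous_mult:
  assumes "nc_homogeneous n f" "n \<le> length w"
  shows "nc_coeff (f * g) w = nc_coeff f (take n w) * nc_coeff g (drop n w)"
proof -
  have "nc_coeff (f * g) w
      = (\<Sum>i\<le>length w. if i = n then nc_coeff f (take n w) * nc_coeff g (drop n w) else 0)"
    unfolding nc_coeff_mult by (rule sum.cong) (use assms in \<open>auto simp: nc_homogeneous_def\<close>)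
  then show ?thesis using assms(2) by simp
qed

lemma nc_homogeneous_mult:
  assumes "nc_homogeneous m f" "nc_homogeneous n g"
  shows "nc_homogeneous (m + n) (f * g)"
  unfolding nc_homogeneous_def nc_coeff_mult
proof (intro allI impI sum.neutral ballI)
  fix w :: "'a list" and i
  assume "length w \<noteq> m + n" "i \<in> {..length w}"
  then have "length (take i w) \<noteq> m \<or> length (drop i w) \<noteq> n" by auto
  then show "nc_coeff f (take i w) * nc_coeff g (drop i w) = 0"
    using assms unfolding nc_homogeneous_def by fastforce
qed

lemma nc_homogeneous_1: "nc_homogeneous 0 1"
  by (simp add: nc_homogeneous_def nc_coeff_1)

lemma nc_homogeneous_var: "nc_homogeneous 1 (nc_var x)"
  by (auto simp: nc_homogeneous_def nc_coeff_var)

lemma nc_homogeneous_power: "nc_homogeneous 1 s \<Longrightarrow> nc_homogeneous k (s ^ k)"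
  using nc_homogeneous_mult[of 1 s] by (induction k) (auto simp: nc_homogeneous_1)

lemma nc_homogeneous_const_mult: "nc_homogeneous n f \<Longrightarrow> nc_homogeneous n (nc_const c * f)"
  by (simp add: nc_homogeneous_def)

lemma nc_homogeneous_add: "nc_homogeneous n f \<Longrightarrow> nc_homogeneous n g \<Longrightarrow> nc_homogeneous n (f + g)"
  by (simp add: nc_homogeneous_def)

lemma nc_homogeneous_diff: "nc_homogeneous n f \<Longrightarrow> nc_homogeneous n g \<Longrightarrow> nc_homogeneous n (f - g)"
  by (simp add: nc_homogeneous_def)

lemma nc_homogeneous_sum: "(\<And>i. i \<in> A \<Longrightarrow> nc_homogeneous n (f i)) \<Longrightarrow> nc_homogeneous n (\<Sum>i\<in>A. f i)"
  by (simp add: nc_homogeneous_def)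


section \<open>Substitution\<close>

lemma finite_lists_length_le_UNIV: "finite {v :: 'y::finite list. length v \<le> n}"
  using finite_lists_length_le[of "UNIV :: 'y set" n] by simp

text \<open>Words longer than \<open>w\<close> are sent to products of too high degree. The freedom
  in \<open>n\<close> gives the prefixes and suffixes of one word a common cutoff, and it admits a
  one-letter word when \<open>w\<close> is empty.\<close>

lemma nc_coeff_subst:
  assumes "\<And>x. nc_coeff (\<sigma> x) [] = 0" "length w \<le> n"
  shows "nc_coeff (nc_subst \<sigma> \<Phi>) w =
    (\<Sum>v | length v \<le> n. nc_coeff \<Phi> v * nc_coeff (prod_list (map \<sigma> v)) w)"
  unfolding nc_subst_def nc_coeff_Abs
proof (rule sum.mono_neutral_left)
  show "\<forall>i\<in>{v. length v \<le> n} - {v. length v \<le> length w}.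
      nc_coeff \<Phi> i * nc_coeff (prod_list (map \<sigma> i)) w = 0"
    by (simp add: nc_coeff_prod_list_eq_0 assms(1))
qed (use assms(2) in \<open>auto simp: finite_lists_length_le_UNIV\<close>)

lemma nc_subst_add: "nc_subst \<sigma> (\<Phi> + \<Gamma>) = nc_subst \<sigma> \<Phi> + nc_subst \<sigma> \<Gamma>"
  by (rule ncseries_eqI) (simp add: nc_subst_def distrib_right sum.distrib)

lemma nc_subst_diff: "nc_subst \<sigma> (\<Phi> - \<Gamma>) = nc_subst \<sigma> \<Phi> - nc_subst \<sigma> \<Gamma>"
  by (rule ncseries_eqI) (simp add: nc_subst_def left_diff_distrib sum_subtractf)

lemma nc_subst_0 [simp]: "nc_subst \<sigma> 0 = 0"
  by (rule ncseries_eqI) (simp add: nc_subst_def)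

lemma nc_subst_sum: "nc_subst \<sigma> (\<Sum>i\<in>A. f i) = (\<Sum>i\<in>A. nc_subst \<sigma> (f i))"
  by (induction A rule: infinite_finite_induct) (simp_all add: nc_subst_add)

text \<open>Both sides enumerate pairs of words \<open>(u, v)\<close>: the product of the images
  does so directly, the image of the product through the word \<open>u @ v\<close> with a marked
  cut.\<close>

lemma nc_subst_mult:
  fixes \<sigma> :: "'y::finite \<Rightarrow> 'x ncseries"
  assumes \<sigma>: "\<And>x. nc_coeff (\<sigma> x) [] = 0"
  shows "nc_subst \<sigma> (\<Phi> * \<Gamma>) = nc_subst \<sigma> \<Phi> * nc_subst \<sigma> \<Gamma>"
proof (rule ncseries_eqI)
  fix w :: "'x list"
  let ?n = "length w" and ?p = "\<lambda>v. prod_list (map \<sigma> v)"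
  let ?L = "{v :: 'y list. length v \<le> ?n}"
  let ?T = "\<lambda>u v. nc_coeff \<Phi> u * nc_coeff \<Gamma> v * nc_coeff (?p u * ?p v) w"
  note fin = finite_lists_length_le_UNIV
  have "nc_coeff (nc_subst \<sigma> \<Phi> * nc_subst \<sigma> \<Gamma>) w = (\<Sum>j\<le>?n.
      (\<Sum>u\<in>?L. nc_coeff \<Phi> u * nc_coeff (?p u) (take j w)) *
      (\<Sum>v\<in>?L. nc_coeff \<Gamma> v * nc_coeff (?p v) (drop j w)))"
    unfolding nc_coeff_mult
    by (intro sum.cong refl arg_cong2[where f = "(*)"] nc_coeff_subst \<sigma>) auto
  also have "\<dots> = (\<Sum>j\<le>?n. \<Sum>u\<in>?L. \<Sum>v\<in>?L. nc_coeff \<Phi> u * nc_coeff \<Gamma> v *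
      (nc_coeff (?p u) (take j w) * nc_coeff (?p v) (drop j w)))"
    unfolding sum_product by (intro sum.cong refl) (simp only: mult_ac)
  also have "\<dots> = (\<Sum>u\<in>?L. \<Sum>v\<in>?L. ?T u v)"
    unfolding nc_coeff_mult sum_distrib_left
    by (subst sum.swap, rule sum.cong[OF refl], subst sum.swap) simp
  also have "\<dots> = (\<Sum>(u,v)\<in>?L \<times> ?L. ?T u v)"
    by (simp add: sum.cartesian_product)
  \<comment> \<open>The image of a pair of total length above \<open>length w\<close> starts in too
    high a degree.\<close>
  also have "\<dots> = (\<Sum>(u,v)\<in>{(u,v). length u + length v \<le> ?n}. ?T u v)"
  proof (rule sum.mono_neutral_right)
    show "\<forall>i\<in>?L \<times> ?L - {(u,v). length u + length v \<le> ?n}. (case i of (u,v) \<Rightarrow> ?T u v) = 0"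
    proof -
      have "nc_coeff (?p u * ?p v) w = 0" if "\<not> length u + length v \<le> ?n" for u v
        using nc_coeff_prod_list_eq_0[OF \<sigma>, where w = w and v = "u @ v"] that by simp
      then show ?thesis by (intro ballI) (simp split: prod.splits)
    qed
  qed (auto simp: fin)
  also have "\<dots> = (\<Sum>(v,i)\<in>(SIGMA v:?L. {..length v}). ?T (take i v) (drop i v))"
    by (rule sum.reindex_bij_witness[where i = "\<lambda>(v,i). (take i v, drop i v)"
          and j = "\<lambda>(u,v). (u @ v, length u)"]) auto
  also have "\<dots> = (\<Sum>v\<in>?L. \<Sum>i\<le>length v. ?T (take i v) (drop i v))"
    by (simp add: sum.Sigma fin)
  also have "\<dots> = (\<Sum>v\<in>?L. \<Sum>i\<le>length v.
      nc_coeff \<Phi> (take i v) * nc_coeff \<Gamma> (drop i v) * nc_coeff (?p v) w)"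
  proof (intro sum.cong refl)
    fix v :: "'y list" and i
    have "?p v = ?p (take i v) * ?p (drop i v)"
      by (metis append_take_drop_id map_append prod_list.append)
    then show "?T (take i v) (drop i v)
        = nc_coeff \<Phi> (take i v) * nc_coeff \<Gamma> (drop i v) * nc_coeff (?p v) w"
      by simp
  qed
  also have "\<dots> = nc_coeff (nc_subst \<sigma> (\<Phi> * \<Gamma>)) w"
    by (simp add: nc_subst_def nc_coeff_mult sum_distrib_right)
  finally show "nc_coeff (nc_subst \<sigma> (\<Phi> * \<Gamma>)) w
      = nc_coeff (nc_subst \<sigma> \<Phi> * nc_subst \<sigma> \<Gamma>) w" ..
qed

lemma nc_subst_const:
  fixes \<sigma> :: "'y::finite \<Rightarrow> 'x ncseries"
  shows "nc_subst \<sigma> (nc_const c) = nc_const c"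
proof (rule ncseries_eqI)
  fix w :: "'x list"
  have "nc_coeff (nc_subst \<sigma> (nc_const c)) w = (\<Sum>v :: 'y list | length v \<le> length w.
      if v = [] then c * nc_coeff 1 w else 0)"
    unfolding nc_subst_def nc_coeff_Abs by (rule sum.cong) (auto simp: nc_coeff_const)
  then show "nc_coeff (nc_subst \<sigma> (nc_const c)) w = nc_coeff (nc_const c) w"
    by (simp add: finite_lists_length_le_UNIV nc_coeff_1 nc_coeff_const)
qed

lemma nc_subst_1 [simp]: "nc_subst \<sigma> 1 = 1"
  using nc_subst_const[of \<sigma> 1] by simp

lemma nc_subst_power:
  assumes "\<And>x. nc_coeff (\<sigma> x) [] = 0"
  shows "nc_subst \<sigma> (\<Phi> ^ k) = nc_subst \<sigma> \<Phi> ^ k"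
  by (induction k) (simp_all add: nc_subst_mult[OF assms])

lemma nc_subst_var:
  assumes "\<And>x. nc_coeff (\<sigma> x) [] = 0"
  shows "nc_subst \<sigma> (nc_var x) = \<sigma> x"
proof (rule ncseries_eqI)
  fix w
  have "nc_coeff (nc_subst \<sigma> (nc_var x)) w = (\<Sum>v | length v \<le> Suc (length w).
      nc_coeff (nc_var x) v * nc_coeff (prod_list (map \<sigma> v)) w)"
    by (rule nc_coeff_subst) (use assms in auto)
  also have "\<dots> = (\<Sum>v | length v \<le> Suc (length w). if v = [x] then nc_coeff (\<sigma> x) w else 0)"
    by (rule sum.cong) (auto simp: nc_coeff_var)
  also have "\<dots> = nc_coeff (\<sigma> x) w"
    by (simp add: finite_lists_length_le_UNIV)
  finally show "nc_coeff (nc_subst \<sigma> (nc_var x)) w = nc_coeff (\<sigma> x) w" .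
qed

text \<open>At the empty word the truncated sum in \<open>nc_subst\<close> consists of the empty
  word only, whatever \<open>\<sigma>\<close> is.\<close>

lemma nc_subst_constant_coeff:
  "nc_coeff (nc_subst \<sigma> \<Phi>) [] = nc_coeff \<Phi> []"
  by (simp add: nc_subst_def nc_coeff_1)


section \<open>Evaluating a univariate power series at a non-commutative series\<close>

text \<open>A series in one non-commutative variable is an ordinary power series.\<close>

definition nc_univariate :: "real fps \<Rightarrow> unit ncseries" where
  "nc_univariate f = Abs_ncseries (\<lambda>v. fps_nth f (length v))"

text \<open>As a substitution, evaluation at a series with zero constant term is a ring homomorphism
  by \<open>nc_subst_mult\<close>, so identities can be proved in \<open>real fps\<close> and
  transported.\<close>

definition nc_eval :: "real fps \<Rightarrow> 'x ncseries \<Rightarrow> 'x ncseries" where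
  "nc_eval f s = nc_subst (\<lambda>_. s) (nc_univariate f)"

lemma nc_univariate_mult: "nc_univariate (f * g) = nc_univariate f * nc_univariate g"
  by (rule ncseries_eqI)
    (simp add: nc_univariate_def nc_coeff_mult fps_mult_nth atLeast0AtMost min_absorb1 min_absorb2)

lemma nc_eval_mult: "nc_coeff s [] = 0 \<Longrightarrow> nc_eval (f * g) s = nc_eval f s * nc_eval g s"
  by (simp add: nc_eval_def nc_univariate_mult nc_subst_mult)

lemma nc_eval_add: "nc_eval (f + g) s = nc_eval f s + nc_eval g s"
proof -
  have "nc_univariate (f + g) = nc_univariate f + nc_univariate g"
    by (rule ncseries_eqI) (simp add: nc_univariate_def)
  then show ?thesis by (simp add: nc_eval_def nc_subst_add)
qed

lemma nc_eval_diff: "nc_eval (f - g) s = nc_eval f s - nc_eval g s"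
proof -
  have "nc_univariate (f - g) = nc_univariate f - nc_univariate g"
    by (rule ncseries_eqI) (simp add: nc_univariate_def)
  then show ?thesis by (simp add: nc_eval_def nc_subst_diff)
qed

lemma nc_eval_const: "nc_eval (fps_const c) s = nc_const c"
proof -
  have "nc_univariate (fps_const c) = nc_const c"
    by (rule ncseries_eqI) (simp add: nc_univariate_def nc_coeff_const)
  then show ?thesis by (simp add: nc_eval_def nc_subst_const)
qed

lemma nc_eval_0 [simp]: "nc_eval 0 s = 0"
  using nc_eval_const[of 0 s] by simp

lemma nc_eval_1 [simp]: "nc_eval 1 s = 1"
  using nc_eval_const[of 1 s] by simp

lemma nc_eval_sum: "nc_eval (\<Sum>i\<in>A. f i) s = (\<Sum>i\<in>A. nc_eval (f i) s)"
  by (induction A rule: infinite_finite_induct) (simp_all add: nc_eval_add)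

lemma nc_eval_X: "nc_coeff s [] = 0 \<Longrightarrow> nc_eval fps_X s = s"
proof -
  assume "nc_coeff s [] = 0"
  have "nc_univariate fps_X = nc_var ()"
  proof (rule ncseries_eqI)
    fix w :: "unit list"
    show "nc_coeff (nc_univariate fps_X) w = nc_coeff (nc_var ()) w"
      by (cases w) (auto simp: nc_univariate_def nc_coeff_var)
  qed
  then show ?thesis using \<open>nc_coeff s [] = 0\<close> by (simp add: nc_eval_def nc_subst_var)
qed

lemma nc_eval_X_power: "nc_coeff s [] = 0 \<Longrightarrow> nc_eval (fps_X ^ k) s = s ^ k"
  by (induction k) (simp_all add: nc_eval_mult nc_eval_X)

text \<open>The tail does not reach words shorter than \<open>n\<close>, and it vanishes for a
  polynomial \<open>f\<close> once \<open>n\<close> exceeds its degree.\<close>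

lemma nc_eval_cutoff:
  assumes "nc_coeff s [] = 0"
  shows "nc_eval f s = (\<Sum>k<n. nc_const (fps_nth f k) * s ^ k) + s ^ n * nc_eval (fps_shift n f) s"
proof -
  have "f = (\<Sum>k<n. fps_const (fps_nth f k) * fps_X ^ k) + fps_X ^ n * fps_shift n f"
    by (rule fps_ext) (auto simp: fps_sum_nth fps_X_power_mult_nth if_distrib cong: if_cong)
  then have "nc_eval f s = nc_eval ((\<Sum>k<n. fps_const (fps_nth f k) * fps_X ^ k)
      + fps_X ^ n * fps_shift n f) s"
    by (rule arg_cong)
  then show ?thesis
    using assms by (simp add: nc_eval_add nc_eval_sum nc_eval_mult nc_eval_const nc_eval_X_power)
qed

lemma nc_coeff_eval:
  assumes "nc_coeff s [] = 0" "length w < n"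
  shows "nc_coeff (nc_eval f s) w = (\<Sum>k<n. fps_nth f k * nc_coeff (s ^ k) w)"
proof -
  have "nc_subdegree_ge (n + 0) (s ^ n * nc_eval (fps_shift n f) s)"
    by (intro nc_subdegree_ge_mult nc_subdegree_ge_power assms) simp
  then show ?thesis
    using assms by (subst nc_eval_cutoff[OF assms(1), of _ n]) (simp add: nc_subdegree_ge_def)
qed

text \<open>Substitution passes through the polynomial head of the evaluation; cut off above
  \<open>length w\<close>, the tails on both sides are invisible in the coefficient of
  \<open>w\<close>.\<close>

lemma nc_subst_eval:
  fixes \<sigma> :: "'y::finite \<Rightarrow> 'x ncseries"
  assumes \<sigma>: "\<And>x. nc_coeff (\<sigma> x) [] = 0" and s: "nc_coeff s [] = 0"
  shows "nc_subst \<sigma> (nc_eval f s) = nc_eval f (nc_subst \<sigma> s)"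
proof (rule ncseries_eqI)
  fix w :: "'x list"
  let ?n = "Suc (length w)" and ?s = "nc_subst \<sigma> s"
  have s': "nc_coeff ?s [] = 0" by (simp add: nc_subst_constant_coeff s)
  have "nc_subst \<sigma> (nc_eval f s) = (\<Sum>k<?n. nc_const (fps_nth f k) * ?s ^ k)
      + ?s ^ ?n * nc_subst \<sigma> (nc_eval (fps_shift ?n f) s)"
    by (subst nc_eval_cutoff[OF s, of _ ?n])
      (simp only: nc_subst_add nc_subst_sum nc_subst_mult[OF \<sigma>] nc_subst_const nc_subst_power[OF \<sigma>])
  moreover have "nc_subdegree_ge (?n + 0) (?s ^ ?n * nc_subst \<sigma> (nc_eval (fps_shift ?n f) s))"
    by (intro nc_subdegree_ge_mult nc_subdegree_ge_power s') simp
  ultimately have "nc_coeff (nc_subst \<sigma> (nc_eval f s)) w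
      = (\<Sum>k<?n. fps_nth f k * nc_coeff (?s ^ k) w)"
    by (simp add: nc_subdegree_ge_def del: sum.lessThan_Suc power_Suc)
  then show "nc_coeff (nc_subst \<sigma> (nc_eval f s)) w = nc_coeff (nc_eval f ?s) w"
    by (subst nc_coeff_eval[OF s', of _ ?n]) simp_all
qed

lemma nc_coeff_eval_homogeneous:
  assumes "nc_homogeneous 1 s"
  shows "nc_coeff (nc_eval f s) w = fps_nth f (length w) * nc_coeff (s ^ length w) w"
proof -
  have "nc_coeff s [] = 0" using assms by (simp add: nc_homogeneous_def)
  then have "nc_coeff (nc_eval f s) w = (\<Sum>k<Suc (length w). fps_nth f k * nc_coeff (s ^ k) w)"
    by (rule nc_coeff_eval) simp
  also have "\<dots> = (\<Sum>k<Suc (length w). if k = length w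
      then fps_nth f (length w) * nc_coeff (s ^ length w) w else 0)"
    by (rule sum.cong) (use nc_homogeneous_power[OF assms] in \<open>auto simp: nc_homogeneous_def\<close>)
  finally show ?thesis by simp
qed

text \<open>This is f(X^2).\<close>

definition fps_double :: "real fps \<Rightarrow> real fps" where
  "fps_double f = Abs_fps (\<lambda>n. if even n then fps_nth f (n div 2) else 0)"

text \<open>The bridge between K0 and K1, which are evaluated at s = t^2, and the Euler relation,
  which is an identity in t. By homogeneity only the power of \<open>t\<close> with exponent
  \<open>length w\<close> contributes.\<close>

lemma nc_eval_square:
  fixes t :: "'x ncseries"
  assumes "nc_homogeneous 1 t"
  shows "nc_eval f (t\<^sup>2) = nc_eval (fps_double f) t"
proof (rule ncseries_eqI)
  fix w :: "'x list"
  let ?n = "length w"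
  have t0: "nc_coeff (t\<^sup>2) [] = 0"
    using nc_homogeneous_power[OF assms, of 2] by (simp add: nc_homogeneous_def)
  have "nc_coeff (nc_eval f (t\<^sup>2)) w = (\<Sum>k<Suc ?n. fps_nth f k * nc_coeff ((t\<^sup>2) ^ k) w)"
    by (rule nc_coeff_eval[OF t0]) simp
  also have "\<dots> = (\<Sum>k<Suc ?n. if 2 * k = ?n then fps_nth f k * nc_coeff (t ^ ?n) w else 0)"
    by (rule sum.cong)
      (use nc_homogeneous_power[OF assms] in \<open>auto simp: nc_homogeneous_def simp flip: power_mult\<close>)
  also have "\<dots> = (if even ?n then fps_nth f (?n div 2) * nc_coeff (t ^ ?n) w else 0)"
  proof (cases "even ?n")
    case True
    then have "(2 * k = ?n) = (k = ?n div 2)" for k by auto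
    then show ?thesis using True by auto
  next
    case False
    then have "2 * k \<noteq> ?n" for k by (metis dvd_triv_left)
    then show ?thesis using False by simp
  qed
  also have "\<dots> = nc_coeff (nc_eval (fps_double f) t) w"
    by (simp add: nc_coeff_eval_homogeneous[OF assms] fps_double_def)
  finally show "nc_coeff (nc_eval f (t\<^sup>2)) w = nc_coeff (nc_eval (fps_double f) t) w" .
qed


section \<open>Rational series\<close>

lemma nc_rational_const: "nc_const c \<in> nc_rational"
  by (rule nc_rational.polynomial, rule finite_subset[of _ "{[]}"])
    (auto simp: nc_coeff_const)

lemma nc_rational_1: "1 \<in> nc_rational"
  using nc_rational_const[of 1] by simp

lemma nc_rational_var: "nc_var x \<in> nc_rational"
  by (rule nc_rational.polynomial, rule finite_subset[of _ "{[x]}"])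
    (auto simp: nc_coeff_var)

lemma nc_rational_0: "0 \<in> nc_rational"
  using nc_rational_const[of 0] by simp

lemma nc_rational_diff:
  assumes "f \<in> nc_rational" "g \<in> nc_rational"
  shows "f - g \<in> nc_rational"
proof -
  have "f - g = f + nc_const (-1) * g" by (rule ncseries_eqI) simp
  then show ?thesis using assms nc_rational.intros nc_rational_const by metis
qed

lemma nc_rational_sum: "(\<And>i. i \<in> A \<Longrightarrow> f i \<in> nc_rational) \<Longrightarrow> (\<Sum>i\<in>A. f i) \<in> nc_rational"
  by (induction A rule: infinite_finite_induct) (auto simp: nc_rational_0 nc_rational.add)

lemma nc_rational_power: "f \<in> nc_rational \<Longrightarrow> f ^ k \<in> nc_rational"
  by (induction k) (auto simp: nc_rational_1 nc_rational.mult)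

text \<open>The inverse is the geometric series evaluated at \<open>f\<close>; both inverse laws are
  images of the one in commuting power series.\<close>

lemma nc_rational_star:
  assumes "f \<in> nc_rational" "nc_coeff f [] = 0"
  obtains g where "g \<in> nc_rational" "(1 - f) * g = 1" "g * (1 - f) = 1"
proof
  let ?g = "nc_eval (inverse (1 - fps_X)) f"
  have inv: "inverse (1 - fps_X) * (1 - fps_X :: real fps) = 1"
    by (rule inverse_mult_eq_1) simp
  then have inv': "(1 - fps_X) * inverse (1 - fps_X) = (1 :: real fps)"
    by (simp only: mult.commute)
  have "nc_eval (1 - fps_X) f = 1 - f"
    by (simp add: nc_eval_diff nc_eval_X assms)
  then show 1: "(1 - f) * ?g = 1" "?g * (1 - f) = 1"
    using arg_cong[OF inv, of "\<lambda>h. nc_eval h f"] arg_cong[OF inv', of "\<lambda>h. nc_eval h f"]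
    by (simp_all add: nc_eval_mult assms(2))
  show "?g \<in> nc_rational"
    by (rule nc_rational.inverse[OF _ _ 1])
      (simp_all add: nc_rational_diff nc_rational_1 assms nc_coeff_1)
qed

text \<open>Multiplication by 1 - X^p subtracts the shift by p and so cancels all coefficients from
  N + p on. Hence \<open>f\<close> is a polynomial divided by 1 - X^p, and 1 - s^p is
  invertible.\<close>

lemma nc_rational_eval_eventually_periodic:
  assumes s: "s \<in> nc_rational" "nc_coeff s [] = 0"
    and "p > 0" and per: "\<And>k. k \<ge> N \<Longrightarrow> fps_nth f (k + p) = fps_nth f k"
  shows "nc_eval f s \<in> nc_rational"
proof -
  have "nc_subdegree_ge p (s ^ p)" by (rule nc_subdegree_ge_power[OF s(2)])
  then have "nc_coeff (s ^ p) [] = 0" using \<open>p > 0\<close> by (simp add: nc_subdegree_ge_def)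
  then obtain g where g: "g \<in> nc_rational" "(1 - s ^ p) * g = 1"
    using nc_rational_star[OF nc_rational_power[OF s(1)]] by metis
  let ?h = "f * (1 - fps_X ^ p)"
  have "fps_shift (N + p) ?h = 0"
  proof (rule fps_ext)
    fix n
    show "fps_nth (fps_shift (N + p) ?h) n = fps_nth 0 n"
      using per[of "n + N"]
      by (simp add: right_diff_distrib fps_X_power_mult_right_nth add.assoc)
  qed
  then have "nc_eval ?h s = (\<Sum>k<N + p. nc_const (fps_nth ?h k) * s ^ k)"
    by (subst nc_eval_cutoff[OF s(2), of _ "N + p"]) simp
  also have "\<dots> \<in> nc_rational"
    by (intro nc_rational_sum nc_rational.mult nc_rational_const nc_rational_power s)
  finally have "nc_eval ?h s \<in> nc_rational" .
  moreover have "nc_eval ?h s = nc_eval f s * (1 - s ^ p)"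
    by (simp only: nc_eval_mult[OF s(2)] nc_eval_diff nc_eval_1 nc_eval_X_power[OF s(2)])
  then have "nc_eval f s = nc_eval ?h s * g"
    using g(2) by (simp add: mult.assoc)
  ultimately show ?thesis using g(1) by (simp add: nc_rational.mult)
qed

text \<open>Elimination of one unknown at a time, by Arden's rule.\<close>

lemma nc_rational_linear_system:
  assumes "finite S"
    and "\<And>u v. u \<in> S \<Longrightarrow> v \<in> S \<Longrightarrow> A u v \<in> nc_rational"
    and "\<And>u v. u \<in> S \<Longrightarrow> v \<in> S \<Longrightarrow> nc_coeff (A u v) [] = 0"
    and "\<And>v. v \<in> S \<Longrightarrow> r v \<in> nc_rational"
  shows "\<exists>X. \<forall>v\<in>S. X v \<in> nc_rational \<and> X v = r v + (\<Sum>u\<in>S. X u * A u v)"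
  using assms
proof (induction S arbitrary: A r rule: finite_induct)
  case (insert a S)
  have "A a a \<in> nc_rational" "nc_coeff (A a a) [] = 0"
    using insert.prems by simp_all
  then obtain g where g: "g \<in> nc_rational" "g * (1 - A a a) = 1"
    by (rule nc_rational_star)
  \<comment> \<open>The equation of \<open>a\<close>, solved by means of \<open>g\<close>, is
    inserted into the remaining ones. Every added term of \<open>?A\<close> has a factor with zero
    constant term, so the smaller system is again proper.\<close>
  let ?A = "\<lambda>u v. A u v + A u a * g * A a v" and ?r = "\<lambda>v. r v + r a * g * A a v"
  have "\<exists>X. \<forall>v\<in>S. X v \<in> nc_rational \<and> X v = ?r v + (\<Sum>u\<in>S. X u * ?A u v)"
  proof (rule insert.IH[of ?A ?r])
    fix u v assume "u \<in> S" "v \<in> S"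
    then have 1: "nc_coeff (A u v) [] = 0" "nc_coeff (A a v) [] = 0"
      using insert.prems by auto
    then show "nc_coeff (?A u v) [] = 0" by (simp add: nc_coeff_mult)
  qed (use insert.prems g in \<open>auto intro!: nc_rational.add nc_rational.mult\<close>)
  then obtain X where XS: "\<And>v. v \<in> S \<Longrightarrow> X v \<in> nc_rational"
    "\<And>v. v \<in> S \<Longrightarrow> X v = ?r v + (\<Sum>u\<in>S. X u * ?A u v)" by blast
  define b where "b = (r a + (\<Sum>u\<in>S. X u * A u a)) * g"
  have b_eq: "b = r a + (\<Sum>u\<in>S. X u * A u a) + b * A a a"
  proof -
    have "b * (1 - A a a) = r a + (\<Sum>u\<in>S. X u * A u a)"
      using g(2) by (simp add: b_def mult.assoc)
    then show ?thesis by (simp add: right_diff_distrib diff_eq_eq)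
  qed
  have "b \<in> nc_rational"
    unfolding b_def using insert.prems XS g
    by (intro nc_rational.add nc_rational.mult nc_rational_sum) auto
  have split: "(\<Sum>u\<in>insert a S. (X(a := b)) u * A u v) = b * A a v + (\<Sum>u\<in>S. X u * A u v)" for v
    using insert.hyps by (subst sum.insert) (auto intro!: arg_cong2[where f = "(+)"] sum.cong)
  have "X v = r v + (b * A a v + (\<Sum>u\<in>S. X u * A u v))" if "v \<in> S" for v
    by (subst XS(2)[OF that])
      (simp add: b_def algebra_simps sum.distrib sum_distrib_left sum_distrib_right)
  then have "(X(a := b)) v = r v + (\<Sum>u\<in>insert a S. (X(a := b)) u * A u v)"
    if "v \<in> insert a S" for v
    unfolding split using that b_eq insert.hyps(2) by (cases "v = a") (simp_all add: add_ac)
  moreover have "(X(a := b)) v \<in> nc_rational" if "v \<in> insert a S" for v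
    using that XS(1) \<open>b \<in> nc_rational\<close> by auto
  ultimately show ?case by blast
qed simp

text \<open>The right-hand side at \<open>w\<close> sees the unknowns at proper prefixes of
  \<open>w\<close> only, since the full prefix is paired with a zero constant term. Induction on the
  length of \<open>w\<close> then determines all coefficients.\<close>

lemma nc_linear_system_unique:
  assumes A: "\<And>u v. u \<in> S \<Longrightarrow> v \<in> S \<Longrightarrow> nc_coeff (A u v) [] = 0"
    and X: "\<And>v. v \<in> S \<Longrightarrow> X v = r v + (\<Sum>u\<in>S. X u * A u v)"
    and Y: "\<And>v. v \<in> S \<Longrightarrow> Y v = r v + (\<Sum>u\<in>S. Y u * A u v)"
    and "v \<in> S"
  shows "X v = Y v"
proof (rule ncseries_eqI)
  fix w
  show "nc_coeff (X v) w = nc_coeff (Y v) w"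
    using \<open>v \<in> S\<close>
  proof (induction w arbitrary: v rule: measure_induct_rule[of length])
    case (less w)
    have "nc_coeff (X u * A u v) w = nc_coeff (Y u * A u v) w" if "u \<in> S" for u
      unfolding nc_coeff_mult
    proof (rule sum.cong[OF refl])
      fix i assume "i \<in> {..length w}"
      then consider "i = length w" | "i < length w" by fastforce
      then show "nc_coeff (X u) (take i w) * nc_coeff (A u v) (drop i w)
          = nc_coeff (Y u) (take i w) * nc_coeff (A u v) (drop i w)"
        by cases (use A less that in auto)
    qed
    then show ?case
      by (subst X[OF less.prems], subst Y[OF less.prems]) simp
  qed
qed


section \<open>Reachability in the level poset\<close>

definition reach :: "real^'v^'v \<Rightarrow> nat \<Rightarrow> 'v \<Rightarrow> 'v \<Rightarrow> bool" where
  "reach M k u v \<longleftrightarrow> matrix_power M k $ u $ v > 0"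

lemma reach_add: "zero_one_matrix M \<Longrightarrow> reach M (j + k) u v \<longleftrightarrow> (\<exists>t. reach M j u t \<and> reach M k t v)"
  unfolding reach_def by (rule matrix_power_add_pos_iff)

text \<open>There are finitely many relations on the vertex set, so two step counts give the same
  one; the relation for N + j steps depends only on j and the relation for N steps, so the
  coincidence propagates.\<close>

lemma reach_eventually_periodic:
  fixes M :: "real^'v^'v"
  assumes M: "zero_one_matrix M"
  obtains N p where "p > 0" "\<And>k. k \<ge> N \<Longrightarrow> reach M (k + p) = reach M k"
proof -
  have "\<not> inj (reach M)"
    using finite_imageD[of "reach M" UNIV] by auto
  then obtain j k where "reach M j = reach M k" "j \<noteq> k"
    by (auto simp: inj_on_def)
  then obtain N N' where N: "reach M N' = reach M N" "N < N'"
    by (metis linorder_neqE_nat)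
  show thesis
  proof (rule that[of "N' - N" N])
    fix k assume "k \<ge> N"
    have "reach M (N' + (k - N)) = reach M (N + (k - N))"
      by (intro ext) (simp only: reach_add[OF M] N(1))
    then show "reach M (k + (N' - N)) = reach M k"
      using \<open>k \<ge> N\<close> N(2) by (simp add: add.commute)
  qed (use N(2) in simp)
qed

lemma level_less_iff_reach:
  "level_less M p q \<longleftrightarrow> snd p < snd q \<and> reach M (nat (snd q - snd p)) (fst p) (fst q)"
  by (simp add: level_less_def reach_def)

lemma level_le_and_neq_iff: "level_le M p q \<and> p \<noteq> q \<longleftrightarrow> level_less M p q"
  by (auto simp: level_le_def level_less_def)

lemma level_less_irrefl: "\<not> level_less M p p"
  by (simp add: level_less_def)

lemma level_open_interval_subset:
  "{z. level_less M p z \<and> level_less M z q} \<subseteq> level_interval M p q"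
  by (auto simp: level_interval_def level_le_def)

lemma finite_level_open_interval: "finite {z. level_less M p z \<and> level_less M z q}"
  by (rule finite_subset[OF level_open_interval_subset finite_level_interval])

text \<open>Interior elements have rank i + 1 with i < n, leaving n - i steps to the top. The shift
  makes i the degree of the ab-index of the lower part.\<close>

lemma sum_level_open_interval:
  fixes M :: "real^'v^'v" and g :: "'v \<times> int \<Rightarrow> 'a :: comm_monoid_add"
  shows "(\<Sum>z | level_less M (x, 0) z \<and> level_less M z (y, int n + 1). g z) =
    (\<Sum>i<n. \<Sum>u\<in>UNIV. if reach M (Suc i) x u \<and> reach M (n - i) u y then g (u, int i + 1) else 0)"
proof -
  let ?P = "\<lambda>(i, u). reach M (Suc i) x u \<and> reach M (n - i) u y"
  have "(\<Sum>z | level_less M (x, 0) z \<and> level_less M z (y, int n + 1). g z)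
      = (\<Sum>(i, u)\<in>{a \<in> {..<n} \<times> UNIV. ?P a}. g (u, int i + 1))"
  proof (rule sum.reindex_bij_witness[where i = "\<lambda>(i, u). (u, int i + 1)"
          and j = "\<lambda>z. (nat (snd z - 1), fst z)"])
    fix z :: "'v \<times> int"
    assume z: "z \<in> {z. level_less M (x, 0) z \<and> level_less M z (y, int n + 1)}"
    then have eq: "Suc (nat (snd z - 1)) = nat (snd z)"
      "n - nat (snd z - 1) = nat (int n + 1 - snd z)" and "nat (snd z - 1) < n"
      by (auto simp: level_less_iff_reach)
    then show "(nat (snd z - 1), fst z) \<in> {a \<in> {..<n} \<times> UNIV. ?P a}"
      using z by (simp add: level_less_iff_reach)
  next
    fix a :: "nat \<times> 'v"
    assume a: "a \<in> {a \<in> {..<n} \<times> UNIV. ?P a}"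
    obtain i u where [simp]: "a = (i, u)" by (cases a)
    have "nat (int i + 1) = Suc i" "nat (int n - int i) = n - i" by auto
    then show "(case a of (i, u) \<Rightarrow> (u, int i + 1))
        \<in> {z. level_less M (x, 0) z \<and> level_less M z (y, int n + 1)}"
      using a by (simp add: level_less_iff_reach)
  qed (auto simp: level_less_iff_reach)
  also have "\<dots> = (\<Sum>a\<in>{..<n} \<times> UNIV. if ?P a then (case a of (i, u) \<Rightarrow> g (u, int i + 1)) else 0)"
    by (rule sum.inter_filter) simp
  also have "\<dots> = (\<Sum>(i, u)\<in>{..<n} \<times> UNIV.
      if reach M (Suc i) x u \<and> reach M (n - i) u y then g (u, int i + 1) else 0)"
    by (rule sum.cong) (auto split: if_splits)
  finally show ?thesis by (simp add: sum.cartesian_product)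
qed

text \<open>The Euler relation of the interval from (u, 0) to (v, m + 2), times (-1)^m: the
  endpoints give the right-hand side and the interior, moved across, the left. It is the coefficient
  of t^(m+1) in K(t) - K(-t) = t K(t) K(-t). If (v, m + 2) is not above (u, 0), both sides are
  zero.\<close>

lemma level_eulerian_reach:
  assumes M: "zero_one_matrix M" and E: "level_eulerian M"
  shows "(\<Sum>i\<le>m. \<Sum>t\<in>UNIV. of_bool (reach M (Suc i) u t) * of_bool (reach M (Suc m - i) t v) * (-1) ^ (m - i))
    = (1 + (-1) ^ m) * (of_bool (reach M (m + 2) u v) :: real)"
proof (cases "reach M (m + 2) u v")
  case False
  have "of_bool (reach M (Suc i) u t) * of_bool (reach M (Suc m - i) t v) = (0 :: real)" if "i \<le> m" for i t
  proof -
    have "Suc i + (Suc m - i) = m + 2" using that by simp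
    then show ?thesis using False reach_add[OF M, of "Suc i" "Suc m - i"] by auto
  qed
  then show ?thesis using False by (simp add: sum.neutral)
next
  case True
  let ?p = "(u, 0 :: int)" and ?q = "(v, int (Suc m) + 1)"
  let ?I = "{z. level_less M ?p z \<and> level_less M z ?q}"
  have pq: "level_less M ?p ?q"
    using True by (simp add: level_less_iff_reach nat_add_distrib)
  then have le: "level_le M ?p ?q" by (simp add: level_le_def)
  then have "eulerian (level_interval M ?p ?q) (level_le M) snd"
    using E unfolding level_eulerian_def by blast
  moreover have "?p \<in> level_interval M ?p ?q" "?q \<in> level_interval M ?p ?q"
    using le by (simp_all add: level_interval_def) (simp_all add: level_le_def)
  ultimately have "(\<Sum>z | z \<in> level_interval M ?p ?q \<and> level_le M ?p z \<and> level_le M z ?q.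
      (-1 :: real) powi snd z) = 0"
    using le unfolding eulerian_def by fastforce
  also have "{z. z \<in> level_interval M ?p ?q \<and> level_le M ?p z \<and> level_le M z ?q}
      = insert ?p (insert ?q ?I)"
    using pq by (auto simp: level_interval_def level_le_def)
  also have "(\<Sum>z\<in>\<dots>. (-1 :: real) powi snd z)
      = (-1) powi 0 + ((-1) powi (int (Suc m) + 1) + (\<Sum>z\<in>?I. (-1) powi snd z))"
    by (subst sum.insert, simp add: finite_level_open_interval, simp add: level_less_irrefl,
        subst sum.insert) (simp_all add: finite_level_open_interval level_less_irrefl)
  also have "(-1 :: real) powi (int (Suc m) + 1) = (-1) ^ m"
    using power_int_of_nat[of "-1 :: real" "Suc (Suc m)"] by (simp add: add.commute)
  also have "(\<Sum>z\<in>?I. (-1 :: real) powi snd z) = (\<Sum>i<Suc m. \<Sum>t\<in>UNIV.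
      if reach M (Suc i) u t \<and> reach M (Suc m - i) t v then (-1) powi (int i + 1) else 0)"
    by (simp only: sum_level_open_interval snd_conv)
  also have "\<dots> = (\<Sum>i\<le>m. \<Sum>t\<in>UNIV. - ((-1) ^ m *
      (of_bool (reach M (Suc i) u t) * of_bool (reach M (Suc m - i) t v) * (-1) ^ (m - i))))"
    unfolding lessThan_Suc_atMost
  proof (intro sum.cong refl)
    fix i t assume "i \<in> {..m}"
    then have "(-1) ^ m = (-1 :: real) ^ i * (-1) ^ (m - i)"
      by (simp flip: power_add)
    then have "(-1) ^ m * (-1) ^ (m - i) = (-1 :: real) ^ i"
      by (simp add: mult.assoc flip: power_mult_distrib)
    moreover have "(-1 :: real) powi (int i + 1) = - ((-1) ^ i)"
      using power_int_of_nat[of "-1 :: real" "Suc i"] by (simp add: add.commute)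
    ultimately show "(if reach M (Suc i) u t \<and> reach M (Suc m - i) t v then (-1) powi (int i + 1) else 0)
        = - ((-1 :: real) ^ m * (of_bool (reach M (Suc i) u t) * of_bool (reach M (Suc m - i) t v) * (-1) ^ (m - i)))"
      by simp
  qed
  also have "\<dots> = - ((-1) ^ m * (\<Sum>i\<le>m. \<Sum>t\<in>UNIV.
      of_bool (reach M (Suc i) u t) * of_bool (reach M (Suc m - i) t v) * (-1) ^ (m - i)))"
    by (simp only: sum_negf sum_distrib_left)
  finally have "1 + (-1) ^ m = (-1 :: real) ^ m * (\<Sum>i\<le>m. \<Sum>t\<in>UNIV.
      of_bool (reach M (Suc i) u t) * of_bool (reach M (Suc m - i) t v) * (-1) ^ (m - i))"
    by simp
  \<comment> \<open>The sign (-1)^m is its own inverse and leaves 1 + (-1)^m unchanged.\<close>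
  then show ?thesis
    using True by (cases "even m") simp_all
qed


section \<open>The ab-index of an interval, one chain element at a time\<close>

text \<open>No ambient interval occurs, unlike in \<open>full_chains\<close>, so the upper end is
  free to move when the last element of a chain is removed.\<close>

definition level_chains :: "real^'v^'v \<Rightarrow> 'v \<times> int \<Rightarrow> 'v \<times> int \<Rightarrow> ('v \<times> int) list set" where
  "level_chains M p q = {c. c \<noteq> [] \<and> hd c = p \<and> last c = q \<and> sorted_wrt (level_less M) c}"

lemma level_chains_same: "level_chains M p p = {[p]}"
proof
  show "level_chains M p p \<subseteq> {[p]}"
  proof
    fix c assume "c \<in> level_chains M p p"
    then have c: "c \<noteq> []" "hd c = p" "last c = p" "sorted_wrt (level_less M) c"
      by (auto simp: level_chains_def)
    then obtain c' where [simp]: "c = p # c'" by (metis list.collapse)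
    have "c' = []"
    proof (rule ccontr)
      assume "c' \<noteq> []"
      then have "p \<in> set c'" using c(3) by (metis \<open>c = p # c'\<close> last.simps last_in_set)
      then have "level_less M p p" using c(4) by simp
      then show False using level_less_irrefl by blast
    qed
    then show "c \<in> {[p]}" by simp
  qed
qed (simp add: level_chains_def)

lemma level_chains_less:
  assumes "c \<in> level_chains M p q" "p \<noteq> q"
  shows "level_less M p q"
proof -
  obtain c' where c: "c = p # c'" using assms(1) by (cases c) (auto simp: level_chains_def)
  then have "c' \<noteq> []" "last c' = q" using assms by (auto simp: level_chains_def split: if_splits)
  then show ?thesis
    using assms(1) c by (metis (mono_tags, lifting) last_in_set level_chains_def mem_Collect_eq sorted_wrt.simps(2))
qed

lemma level_chains_subset_interval:
  assumes "c \<in> level_chains M p q"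
  shows "set c \<subseteq> level_interval M p q"
proof
  fix z assume z: "z \<in> set c"
  have c: "c \<noteq> []" "hd c = p" "last c = q" "sorted_wrt (level_less M) c"
    using assms by (auto simp: level_chains_def)
  obtain c1 where c1: "c = p # c1" using c(1,2) by (metis list.collapse)
  obtain c2 where c2: "c = c2 @ [q]" using c(1,3) by (metis append_butlast_last_id)
  have "level_le M p z" using z c(4) unfolding c1 by (auto simp: level_le_def)
  moreover have "level_le M z q"
    using z c(4) unfolding c2 by (auto simp: level_le_def sorted_wrt_append)
  ultimately show "z \<in> level_interval M p q" by (simp add: level_interval_def)
qed

lemma finite_level_chains: "finite (level_chains M p q)"
proof (rule finite_subset)
  have "distinct c" if "sorted_wrt (level_less M) c" for c
    using that by (induction c) (auto simp: level_less_irrefl)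
  then show "level_chains M p q \<subseteq> {c. set c \<subseteq> level_interval M p q \<and> distinct c}"
    using level_chains_subset_interval[of _ M p q] unfolding level_chains_def by blast
qed (rule finite_subset_distinct[OF finite_level_interval])

lemma full_chains_level_interval:
  assumes pq: "level_le M p q"
  shows "full_chains (level_interval M p q) (level_le M) = level_chains M p q"
proof -
  have anti: "a = b" if "level_le M a b" "level_le M b a" for a b
    using that by (auto simp: level_le_def level_less_def)
  have mem: "p \<in> level_interval M p q" "q \<in> level_interval M p q"
    using pq by (simp_all add: level_interval_def) (simp_all add: level_le_def)
  show ?thesis
  proof (intro equalityI subsetI)
    fix c assume "c \<in> full_chains (level_interval M p q) (level_le M)"
    then have c: "c \<noteq> []" "set c \<subseteq> level_interval M p q" "sorted_wrt (level_less M) c"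
      "level_le M (hd c) p" "level_le M q (last c)"
      using mem by (auto simp: full_chains_def level_le_and_neq_iff)
    then have "hd c \<in> level_interval M p q" "last c \<in> level_interval M p q" by auto
    then have "hd c = p" "last c = q"
      using c(4,5) anti by (auto simp: level_interval_def)
    then show "c \<in> level_chains M p q" using c by (simp add: level_chains_def)
  next
    fix c assume "c \<in> level_chains M p q"
    then show "c \<in> full_chains (level_interval M p q) (level_le M)"
      using level_chains_subset_interval[of c M p q]
      by (auto simp: full_chains_def level_chains_def level_le_and_neq_iff level_interval_def)
  qed
qed

text \<open>Here \<open>z\<close> is the element just below \<open>q\<close> in the chain; the value
  \<open>p\<close> accounts for the two-element chain.\<close>

lemma level_chains_snoc:
  assumes M: "zero_one_matrix M" and "level_less M p q"
  shows "level_chains M p q = (\<Union>z\<in>insert p {z. level_less M p z \<and> level_less M z q}.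
    (\<lambda>c. c @ [q]) ` level_chains M p z)" (is "_ = ?R")
proof (intro equalityI subsetI)
  fix c assume c: "c \<in> level_chains M p q"
  then have "c = butlast c @ [q]"
    by (auto simp: level_chains_def)
  then obtain c' where c': "c = c' @ [q]" by blast
  have "p \<noteq> q" using assms(2) level_less_irrefl by blast
  then have "c' \<noteq> []" using c c' by (auto simp: level_chains_def)
  then have mem: "c' \<in> level_chains M p (last c')" and lt: "level_less M (last c') q"
    using c c' by (auto simp: level_chains_def sorted_wrt_append)
  have "last c' \<in> insert p {z. level_less M p z \<and> level_less M z q}"
    using level_chains_less[OF mem] lt by blast
  then show "c \<in> ?R" using mem c' by blast
next
  fix c assume "c \<in> ?R"
  then obtain z c' where c': "c = c' @ [q]" "c' \<in> level_chains M p z"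
    and "z \<in> insert p {z. level_less M p z \<and> level_less M z q}"
    by blast
  then have z: "level_less M z q"
    using assms(2) by blast
  have "level_less M a q" if "a \<in> set c'" for a
  proof -
    have "level_le M a z"
      using level_chains_subset_interval[OF c'(2)] that by (auto simp: level_interval_def)
    then show ?thesis using z level_less_trans[OF M] unfolding level_le_def by blast
  qed
  then show "c \<in> level_chains M p q"
    using c' by (auto simp: level_chains_def sorted_wrt_append)
qed

text \<open>The old last element becomes interior and contributes the factor b. In a one-element
  chain it is also the minimum and contributes none, hence the bound on the length.\<close>

lemma chain_wt_snoc:
  "length c \<ge> 2 \<Longrightarrow> chain_wt \<rho> (c @ [z]) =
    chain_wt \<rho> c * nc_var Vb * (nc_var Va - nc_var Vb) ^ nat (\<rho> z - \<rho> (last c) - 1)"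
  by (induction \<rho> c rule: chain_wt.induct) (simp_all add: mult.assoc)

lemma sum_chain_wt_step:
  assumes M: "zero_one_matrix M" and pq: "level_less M p q"
  shows "(\<Sum>c\<in>level_chains M p q. chain_wt snd c) =
    (nc_var Va - nc_var Vb) ^ nat (snd q - snd p - 1) +
    (\<Sum>z | level_less M p z \<and> level_less M z q. (\<Sum>c\<in>level_chains M p z. chain_wt snd c) *
      (nc_var Vb * (nc_var Va - nc_var Vb) ^ nat (snd q - snd z - 1)))"
proof -
  let ?I = "{z. level_less M p z \<and> level_less M z q}"
  have "(\<Sum>c\<in>level_chains M p q. chain_wt snd c)
      = (\<Sum>z\<in>insert p ?I. \<Sum>c\<in>(\<lambda>c. c @ [q]) ` level_chains M p z. chain_wt snd c)"
    unfolding level_chains_snoc[OF M pq]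
    by (rule sum.UNION_disjoint)
      (simp_all add: finite_level_open_interval finite_level_chains, auto simp: level_chains_def)
  also have "\<dots> = (\<Sum>z\<in>insert p ?I. \<Sum>c\<in>level_chains M p z. chain_wt snd (c @ [q]))"
    by (rule sum.cong[OF refl], subst sum.reindex) (auto simp: inj_on_def)
  also have "\<dots> = (\<Sum>c\<in>level_chains M p p. chain_wt snd (c @ [q])) +
      (\<Sum>z\<in>?I. \<Sum>c\<in>level_chains M p z. chain_wt snd (c @ [q]))"
    by (rule sum.insert) (auto simp: finite_level_open_interval level_less_irrefl)
  also have "(\<Sum>c\<in>level_chains M p p. chain_wt snd (c @ [q]))
      = (nc_var Va - nc_var Vb) ^ nat (snd q - snd p - 1)"
    by (simp add: level_chains_same)
  also have "(\<Sum>z\<in>?I. \<Sum>c\<in>level_chains M p z. chain_wt snd (c @ [q]))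
      = (\<Sum>z\<in>?I. (\<Sum>c\<in>level_chains M p z. chain_wt snd c) *
        (nc_var Vb * (nc_var Va - nc_var Vb) ^ nat (snd q - snd z - 1)))"
    unfolding sum_distrib_right
  proof (intro sum.cong refl)
    fix z c assume z: "z \<in> ?I" and c: "c \<in> level_chains M p z"
    have ne: "p \<noteq> z" using z level_less_irrefl by blast
    obtain c' where c': "c = p # c'" using c by (cases c) (auto simp: level_chains_def)
    have "last c = z" "c' \<noteq> []" using c c' ne by (auto simp: level_chains_def)
    then have "length c \<ge> 2" using c' by (cases c') auto
    then show "chain_wt snd (c @ [q]) = chain_wt snd c *
        (nc_var Vb * (nc_var Va - nc_var Vb) ^ nat (snd q - snd z - 1))"
      using \<open>last c = z\<close> by (simp add: chain_wt_snoc mult.assoc)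
  qed
  finally show ?thesis .
qed

lemma level_ab_index_eq_sum:
  "level_ab_index M x y m = (\<Sum>c\<in>level_chains M (x, 0) (y, int m + 1). chain_wt snd c)"
proof (cases "level_le M (x, 0) (y, int m + 1)")
  case False
  then have "level_chains M (x, 0) (y, int m + 1) = {}"
    using level_chains_less[of _ M "(x, 0)" "(y, int m + 1)"] by (auto simp: level_le_def)
  then show ?thesis using False by (simp add: level_ab_index_def)
qed (simp add: level_ab_index_def ab_index_def full_chains_level_interval)

text \<open>The indicators absorb the side conditions, so the recurrence also holds when (y, m + 1)
  is out of reach: then every product on the right has a zero factor. Cutting at level i + 1 leaves
  an upper interval of rank m - i, whence the exponent m - i - 1.\<close>

lemma level_ab_index_step:
  fixes M :: "real^'v^'v"
  assumes M: "zero_one_matrix M"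
  defines "t \<equiv> nc_var Va - nc_var Vb"
  shows "level_ab_index M x y m = nc_const (of_bool (reach M (Suc m) x y)) * t ^ m +
    (\<Sum>i<m. \<Sum>u\<in>UNIV. level_ab_index M x u i *
      (nc_var Vb * (nc_const (of_bool (reach M (m - i) u y)) * t ^ (m - Suc i))))"
proof -
  let ?p = "(x, 0 :: int)" and ?q = "(y, int m + 1)"
  have lt_iff: "level_less M ?p (u, int i + 1) \<longleftrightarrow> reach M (Suc i) x u" for u i
  proof -
    have "nat (int i + 1) = Suc i" by simp
    then show ?thesis by (simp add: level_less_iff_reach)
  qed
  have zero: "level_ab_index M x u i = 0" if "\<not> reach M (Suc i) x u" for u i
    using that lt_iff[of u i] by (simp add: level_ab_index_def level_le_def)
  show ?thesis
  proof (cases "reach M (Suc m) x y")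
    case True
    then have "level_less M ?p ?q" by (simp add: lt_iff)
    then have "level_ab_index M x y m = t ^ m +
      (\<Sum>z | level_less M ?p z \<and> level_less M z ?q. (\<Sum>c\<in>level_chains M ?p z. chain_wt snd c) *
        (nc_var Vb * t ^ nat (snd ?q - snd z - 1)))"
      unfolding level_ab_index_eq_sum t_def
      using sum_chain_wt_step[OF M, of ?p ?q] by simp
    also have "\<dots> = t ^ m + (\<Sum>i<m. \<Sum>u\<in>UNIV. if reach M (Suc i) x u \<and> reach M (m - i) u y
      then level_ab_index M x u i * (nc_var Vb * t ^ (m - Suc i)) else 0)"
    proof -
      have "nat (int m - int i - 1) = m - Suc i" for i by simp
      then show ?thesis
        by (subst sum_level_open_interval) (simp add: level_ab_index_eq_sum cong: if_cong)
    qed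
    also have "\<dots> = nc_const (of_bool (reach M (Suc m) x y)) * t ^ m +
      (\<Sum>i<m. \<Sum>u\<in>UNIV. level_ab_index M x u i *
      (nc_var Vb * (nc_const (of_bool (reach M (m - i) u y)) * t ^ (m - Suc i))))"
      using True by (intro arg_cong2[where f = "(+)"] sum.cong refl) (auto simp: zero)
    finally show ?thesis .
  next
    case False
    have "level_ab_index M x u i *
      (nc_var Vb * (nc_const (of_bool (reach M (m - i) u y)) * t ^ (m - Suc i))) = 0"
      if "i < m" for i u
    proof -
      have "Suc m = Suc i + (m - i)" using that by simp
      then have "\<not> reach M (Suc i) x u \<or> \<not> reach M (m - i) u y"
        using False reach_add[OF M] by metis
      then show ?thesis using zero by auto
    qed
    then show ?thesis using False zero[of m y] by simp
  qed
qed

lemma nc_homogeneous_a_minus_b: "nc_homogeneous 1 (nc_var Va - nc_var Vb)"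
  by (intro nc_homogeneous_diff nc_homogeneous_var)

text \<open>In the recurrence the degrees i, 1 and m - i - 1 add up to m. Homogeneity collapses the
  sum over all degrees in \<open>ab_series\<close> to one term.\<close>

lemma nc_homogeneous_level_ab_index:
  assumes "zero_one_matrix M"
  shows "nc_homogeneous m (level_ab_index M x y m)"
proof (induction m arbitrary: y rule: less_induct)
  case (less m)
  let ?t = "nc_var Va - nc_var Vb"
  show ?case
    unfolding level_ab_index_step[OF assms, of x y m]
  proof (intro nc_homogeneous_add nc_homogeneous_sum)
    fix i u assume "i \<in> {..<m}"
    then have "m = i + (1 + (m - Suc i))" and "i < m" by auto
    then show "nc_homogeneous m (level_ab_index M x u i *
      (nc_var Vb * (nc_const (of_bool (reach M (m - i) u y)) * ?t ^ (m - Suc i))))"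
      by (metis less nc_homogeneous_mult nc_homogeneous_var nc_homogeneous_const_mult
          nc_homogeneous_power nc_homogeneous_a_minus_b)
  qed (intro nc_homogeneous_const_mult nc_homogeneous_power nc_homogeneous_a_minus_b)
qed

lemma nc_coeff_ab_series:
  assumes "zero_one_matrix M"
  shows "nc_coeff (ab_series M x y) w = nc_coeff (level_ab_index M x y (length w)) w"
proof -
  have "(\<Sum>m. nc_coeff (level_ab_index M x y m) w)
      = (\<Sum>m\<in>{length w}. nc_coeff (level_ab_index M x y m) w)"
    by (rule suminf_finite)
      (use nc_homogeneous_level_ab_index[OF assms] in \<open>auto simp: nc_homogeneous_def\<close>)
  then show ?thesis by (simp add: ab_series_def)
qed

text \<open>The entries of K; the exponent is one less than the number of steps, as in the weight of
  a chain.\<close>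

definition reach_fps :: "real^'v^'v \<Rightarrow> 'v \<Rightarrow> 'v \<Rightarrow> real fps" where
  "reach_fps M u v = Abs_fps (\<lambda>n. of_bool (reach M (Suc n) u v))"

lemma ab_series_linear_system:
  fixes M :: "real^'v^'v"
  assumes M: "zero_one_matrix M"
  defines "t \<equiv> nc_var Va - nc_var Vb"
  shows "ab_series M x y = nc_eval (reach_fps M x y) t +
    (\<Sum>u\<in>UNIV. ab_series M x u * (nc_var Vb * nc_eval (reach_fps M u y) t))"
proof (rule ncseries_eqI)
  fix w :: "ab list"
  let ?n = "length w" and ?L = "level_ab_index M x"
  let ?g = "\<lambda>u. nc_var Vb * nc_eval (reach_fps M u y) t"
  let ?h = "\<lambda>u i. nc_var Vb * (nc_const (of_bool (reach M (?n - i) u y)) * t ^ (?n - Suc i))"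
  have t: "nc_homogeneous 1 t" unfolding t_def by (rule nc_homogeneous_a_minus_b)
  have "nc_coeff (ab_series M x u * ?g u) w = (\<Sum>i<?n. nc_coeff (?L u i * ?h u i) w)" for u
  proof -
    have "nc_coeff (ab_series M x u * ?g u) w
        = (\<Sum>i\<le>?n. nc_coeff (?L u i) (take i w) * nc_coeff (?g u) (drop i w))"
      by (simp add: nc_coeff_mult[of "ab_series M x u"] nc_coeff_ab_series[OF M] min_absorb1 min_absorb2)
    \<comment> \<open>The cut at the end of \<open>w\<close> drops out: a series that begins with b
      has zero constant term.\<close>
    also have "\<dots> = (\<Sum>i<?n. nc_coeff (?L u i) (take i w) * nc_coeff (?g u) (drop i w))"
      by (simp add: lessThan_Suc_atMost[symmetric] nc_coeff_mult[of "nc_var Vb"] nc_coeff_var)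
    also have "\<dots> = (\<Sum>i<?n. nc_coeff (?L u i * ?h u i) w)"
    proof (rule sum.cong[OF refl])
      fix i assume "i \<in> {..<?n}"
      then have i: "i < ?n" by simp
      then have "nc_coeff (?g u) (drop i w) = nc_coeff (?h u i) (drop i w)"
        by (simp add: nc_coeff_homogeneous_mult[OF nc_homogeneous_var]
            nc_coeff_eval_homogeneous[OF t] reach_fps_def Suc_diff_Suc)
      then show "nc_coeff (?L u i) (take i w) * nc_coeff (?g u) (drop i w) = nc_coeff (?L u i * ?h u i) w"
        using i nc_coeff_homogeneous_mult[OF nc_homogeneous_level_ab_index[OF M]] by simp
    qed
    finally show ?thesis .
  qed
  then show "nc_coeff (ab_series M x y) w = nc_coeff (nc_eval (reach_fps M x y) t +
      (\<Sum>u\<in>UNIV. ab_series M x u * ?g u)) w"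
    unfolding nc_coeff_ab_series[OF M] level_ab_index_step[OF M, of x y ?n, folded t_def]
    by (simp add: nc_coeff_eval_homogeneous[OF t] reach_fps_def sum.swap[of _ UNIV])
qed


section \<open>The Eulerian relation and the linear system over cd\<close>

text \<open>This is K0, and \<open>reach_fps_odd\<close> is K1. The names refer to the parity of the
  exponent of t, so the step counts have the opposite parity.\<close>

definition reach_fps_even :: "real^'v^'v \<Rightarrow> 'v \<Rightarrow> 'v \<Rightarrow> real fps" where
  "reach_fps_even M u v = Abs_fps (\<lambda>k. of_bool (reach M (2 * k + 1) u v))"

definition reach_fps_odd :: "real^'v^'v \<Rightarrow> 'v \<Rightarrow> 'v \<Rightarrow> real fps" where
  "reach_fps_odd M u v = Abs_fps (\<lambda>k. of_bool (reach M (2 * k + 2) u v))"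

text \<open>This is K(-t), built from K0 and K1 instead of signs, so that evaluation at t yields
  K0(t^2) - t K1(t^2) at once.\<close>

definition reach_fps_alt :: "real^'v^'v \<Rightarrow> 'v \<Rightarrow> 'v \<Rightarrow> real fps" where
  "reach_fps_alt M u v =
    fps_double (reach_fps_even M u v) - fps_X * fps_double (reach_fps_odd M u v)"

lemma reach_fps_alt_nth: "fps_nth (reach_fps_alt M u v) n = (-1) ^ n * of_bool (reach M (Suc n) u v)"
proof (cases "even n")
  case True
  then obtain k where "n = 2 * k" by (rule evenE)
  then show ?thesis
    by (cases k) (auto simp: reach_fps_alt_def fps_double_def reach_fps_even_def reach_fps_odd_def)
next
  case False
  then obtain k where "n = 2 * k + 1" by (rule oddE)
  then show ?thesis
    by (auto simp: reach_fps_alt_def fps_double_def reach_fps_even_def reach_fps_odd_def)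
qed

lemma reach_fps_eq:
  "reach_fps M u v = fps_double (reach_fps_even M u v) + fps_X * fps_double (reach_fps_odd M u v)"
proof (rule fps_ext)
  fix n
  show "fps_nth (reach_fps M u v) n =
    fps_nth (fps_double (reach_fps_even M u v) + fps_X * fps_double (reach_fps_odd M u v)) n"
  proof (cases "even n")
    case True
    then obtain k where "n = 2 * k" by (rule evenE)
    then show ?thesis
      by (cases k) (auto simp: reach_fps_def fps_double_def reach_fps_even_def reach_fps_odd_def)
  next
    case False
    then obtain k where "n = 2 * k + 1" by (rule oddE)
    then show ?thesis
      by (auto simp: reach_fps_def fps_double_def reach_fps_even_def reach_fps_odd_def)
  qed
qed

text \<open>Coefficient m + 1 is \<open>level_eulerian_reach\<close> at m; at 0 both sides vanish,
  as K(t) and K(-t) have the same constant term.\<close>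

lemma reach_fps_mult_alt:
  assumes M: "zero_one_matrix M" and E: "level_eulerian M"
  shows "fps_X * (\<Sum>t\<in>UNIV. reach_fps M u t * reach_fps_alt M t v)
    = reach_fps M u v - reach_fps_alt M u v"
proof (rule fps_ext)
  fix n
  show "fps_nth (fps_X * (\<Sum>t\<in>UNIV. reach_fps M u t * reach_fps_alt M t v)) n
    = fps_nth (reach_fps M u v - reach_fps_alt M u v) n"
  proof (cases n)
    case 0
    then show ?thesis by (simp add: reach_fps_alt_nth reach_fps_def)
  next
    case (Suc m)
    have "fps_nth (fps_X * (\<Sum>t\<in>UNIV. reach_fps M u t * reach_fps_alt M t v)) n
      = (\<Sum>t\<in>UNIV. \<Sum>i\<le>m. of_bool (reach M (Suc i) u t) *
          ((-1) ^ (m - i) * of_bool (reach M (Suc (m - i)) t v)))"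
      unfolding Suc fps_X_mult_nth unfolding fps_sum_nth fps_mult_nth reach_fps_alt_nth
      by (simp add: reach_fps_def atLeast0AtMost)
    also have "\<dots> = (\<Sum>i\<le>m. \<Sum>t\<in>UNIV.
        of_bool (reach M (Suc i) u t) * of_bool (reach M (Suc m - i) t v) * (-1) ^ (m - i))"
      by (subst sum.swap, intro sum.cong refl) (simp add: Suc_diff_le)
    also have "\<dots> = (1 + (-1) ^ m) * of_bool (reach M (m + 2) u v)"
      by (rule level_eulerian_reach[OF M E])
    also have "\<dots> = fps_nth (reach_fps M u v - reach_fps_alt M u v) n"
      by (simp add: Suc reach_fps_alt_nth reach_fps_def)
    finally show ?thesis .
  qed
qed

text \<open>Taking half of K(t) - K(-t) away from K(t) leaves the average of K(t) and K(-t), which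
  is the even part; this is the origin of the factor 1/2.\<close>

lemma reach_fps_mult_even:
  assumes M: "zero_one_matrix M" and E: "level_eulerian M"
  shows "(\<Sum>t\<in>UNIV. reach_fps M u t *
      (of_bool (t = v) - fps_const (1/2) * (fps_X * reach_fps_alt M t v)))
    = fps_double (reach_fps_even M u v)"
proof -
  have "(\<Sum>t\<in>UNIV. reach_fps M u t * (of_bool (t = v) - fps_const (1/2) * (fps_X * reach_fps_alt M t v)))
      = reach_fps M u v - fps_const (1/2) * (fps_X * (\<Sum>t\<in>UNIV. reach_fps M u t * reach_fps_alt M t v))"
  proof -
    have "(\<Sum>t\<in>UNIV. reach_fps M u t * of_bool (t = v)) = (\<Sum>t\<in>UNIV. if t = v then reach_fps M u v else 0)"
      by (rule sum.cong) auto
    then show ?thesis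
      unfolding right_diff_distrib[of "reach_fps M u _"] sum_subtractf sum_distrib_left
      by (simp only: sum.delta finite UNIV_I if_True mult_ac)
  qed
  also have "\<dots> = reach_fps M u v - fps_const (1/2) * (reach_fps M u v - reach_fps_alt M u v)"
    by (simp only: reach_fps_mult_alt[OF M E])
  also have "\<dots> = fps_double (reach_fps_even M u v)"
    by (rule fps_ext) (simp add: reach_fps_eq reach_fps_alt_def field_simps)
  finally show ?thesis .
qed

lemma nc_const_half_sum: "nc_const (1/2) * (f + g) = g + nc_const (1/2) * (f - g)"
  by (rule ncseries_eqI) (simp add: field_simps)

lemma ab_series_cd_linear_system:
  fixes M :: "real^'v^'v"
  assumes M: "zero_one_matrix M" and E: "level_eulerian M"
  defines "t \<equiv> nc_var Va - nc_var Vb"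
  shows "ab_series M x y = nc_eval (reach_fps_even M x y) (t\<^sup>2) +
    (\<Sum>u\<in>UNIV. ab_series M x u * (nc_const (1/2) *
      ((nc_var Va + nc_var Vb) * nc_eval (reach_fps_even M u y) (t\<^sup>2)
        - t\<^sup>2 * nc_eval (reach_fps_odd M u y) (t\<^sup>2))))"
proof -
  let ?\<Psi> = "ab_series M x" and ?b = "nc_var Vb" and ?h = "nc_const (1/2) :: ab ncseries"
  let ?K = "\<lambda>u v. nc_eval (reach_fps M u v) t"
  let ?E = "\<lambda>u v. nc_eval (reach_fps_even M u v) (t\<^sup>2)"
  let ?O = "\<lambda>u v. nc_eval (reach_fps_odd M u v) (t\<^sup>2)"
  \<comment> \<open>\<open>?g\<close> is t K(-t) / 2 in terms of K0 and K1, and \<open>?f\<close> is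
    the multiplier.\<close>
  let ?g = "\<lambda>u v. ?h * (t * (?E u v - t * ?O u v))"
  let ?f = "\<lambda>u v. of_bool (u = v) - ?g u v"
  have t: "nc_homogeneous 1 t" unfolding t_def by (rule nc_homogeneous_a_minus_b)
  then have t0: "nc_coeff t [] = 0" by (simp add: nc_homogeneous_def)
  have kf: "(\<Sum>v\<in>UNIV. ?K u v * ?f v y) = ?E u y" for u
  proof -
    have "nc_eval (of_bool P) t = of_bool P" for P by (cases P) simp_all
    then have "(\<Sum>v\<in>UNIV. ?K u v * ?f v y) = nc_eval (\<Sum>v\<in>UNIV. reach_fps M u v *
        (of_bool (v = y) - fps_const (1/2) * (fps_X * reach_fps_alt M v y))) t"
      by (simp only: nc_eval_square[OF t] reach_fps_alt_def nc_eval_sum nc_eval_mult[OF t0]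
          nc_eval_diff nc_eval_const nc_eval_X[OF t0])
    then show ?thesis
      by (simp only: reach_fps_mult_even[OF M E] nc_eval_square[OF t])
  qed
  have "?\<Psi> y - (\<Sum>v\<in>UNIV. ?\<Psi> v * ?g v y) = (\<Sum>v\<in>UNIV. ?\<Psi> v * ?f v y)"
  proof -
    have "(\<Sum>v\<in>UNIV. ?\<Psi> v * of_bool (v = y)) = (\<Sum>v\<in>UNIV. if v = y then ?\<Psi> y else 0)"
      by (rule sum.cong) auto
    then show ?thesis
      by (simp only: right_diff_distrib[of "?\<Psi> _"] sum_subtractf sum.delta finite UNIV_I if_True)
  qed
  also have "\<dots> = (\<Sum>v\<in>UNIV. (?K x v + (\<Sum>u\<in>UNIV. ?\<Psi> u * (?b * ?K u v))) * ?f v y)"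
    unfolding t_def by (subst ab_series_linear_system[OF M]) (rule refl)
  \<comment> \<open>Exchanging the two sums over vertices lets the multiplier meet K in the second
    term as well.\<close>
  also have "\<dots> = (\<Sum>v\<in>UNIV. ?K x v * ?f v y) + (\<Sum>u\<in>UNIV. ?\<Psi> u * (?b * (\<Sum>v\<in>UNIV. ?K u v * ?f v y)))"
    unfolding distrib_right sum.distrib sum_distrib_left sum_distrib_right mult.assoc
    by (subst sum.swap) (rule refl)
  also have "\<dots> = ?E x y + (\<Sum>u\<in>UNIV. ?\<Psi> u * (?b * ?E u y))"
    by (simp only: kf)
  finally have "?\<Psi> y = ?E x y + (\<Sum>u\<in>UNIV. ?\<Psi> u * (?b * ?E u y + ?g u y))"
    by (simp add: diff_eq_eq distrib_left sum.distrib add.assoc)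
  moreover have "?b * ?E u y + ?g u y
      = ?h * ((nc_var Va + ?b) * ?E u y - t\<^sup>2 * ?O u y)" for u
  proof -
    have "?h * ((nc_var Va + ?b) * ?E u y - t\<^sup>2 * ?O u y)
        = (?h * (nc_var Va + ?b)) * ?E u y - ?h * (t * (t * ?O u y))"
      by (simp only: right_diff_distrib mult.assoc power2_eq_square)
    also have "?h * (nc_var Va + ?b) = ?b + ?h * t"
      unfolding t_def by (rule nc_const_half_sum)
    also have "(?b + ?h * t) * ?E u y - ?h * (t * (t * ?O u y)) = ?b * ?E u y + ?g u y"
      by (simp only: distrib_right right_diff_distrib mult.assoc add_diff_eq)
    finally show ?thesis ..
  qed
  ultimately show ?thesis by simp
qed

section \<open>Rationality of the system over c and d, and the conclusion\<close>

lemma nc_rational_eval_reach: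
  fixes M :: "real^'v^'v"
  assumes M: "zero_one_matrix M" and s: "s \<in> nc_rational" "nc_coeff s [] = 0"
  shows "nc_eval (reach_fps_even M u v) s \<in> nc_rational"
    and "nc_eval (reach_fps_odd M u v) s \<in> nc_rational"
proof -
  obtain N p where "p > 0" and per: "\<And>k. k \<ge> N \<Longrightarrow> reach M (k + p) = reach M k"
    using reach_eventually_periodic[OF M] by metis
  \<comment> \<open>Raising k by p raises the step counts 2 k + 1 and 2 k + 2 by 2 p.\<close>
  have per2: "reach M (k + 2 * p) = reach M k" if "k \<ge> N" for k
    using per[of k] per[of "k + p"] that by (simp add: mult_2 add.assoc)
  have "reach M (2 * (k + p) + 1) = reach M (2 * k + 1)" if "k \<ge> N" for k
    using per2[of "2 * k + 1"] that by (simp add: algebra_simps)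
  then show "nc_eval (reach_fps_even M u v) s \<in> nc_rational"
    by (intro nc_rational_eval_eventually_periodic[OF s \<open>p > 0\<close>, of N])
      (simp add: reach_fps_even_def)
  have "reach M (2 * (k + p) + 2) = reach M (2 * k + 2)" if "k \<ge> N" for k
    using per2[of "2 * k + 2"] that by (simp add: algebra_simps)
  then show "nc_eval (reach_fps_odd M u v) s \<in> nc_rational"
    by (intro nc_rational_eval_eventually_periodic[OF s \<open>p > 0\<close>, of N])
      (simp add: reach_fps_odd_def)
qed

lemma cd_to_ab_constant_coeff: "nc_coeff (cd_to_ab z) [] = 0"
  by (cases z) (simp_all add: nc_coeff_var nc_coeff_mult)

text \<open>The square of c contains ab and ba once each; subtracting 2 d reverses both
  signs.\<close>

lemma a_minus_b_square:
  "nc_subst cd_to_ab ((nc_var Vc)\<^sup>2 - nc_const 2 * nc_var Vd) = (nc_var Va - nc_var Vb)\<^sup>2"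
proof -
  have "nc_const 2 * f = f + f" for f :: "ab ncseries"
    by (rule ncseries_eqI) simp
  moreover have "nc_subst cd_to_ab ((nc_var Vc)\<^sup>2 - nc_const 2 * nc_var Vd)
      = (cd_to_ab Vc)\<^sup>2 - nc_const 2 * cd_to_ab Vd"
    by (simp only: nc_subst_diff nc_subst_power[OF cd_to_ab_constant_coeff]
        nc_subst_mult[OF cd_to_ab_constant_coeff] nc_subst_const nc_subst_var[OF cd_to_ab_constant_coeff])
  ultimately show ?thesis
    by (simp add: power2_eq_square algebra_simps)
qed

theorem theorem7p4:
  fixes M :: "real^'v^'v" and x y :: 'v
  assumes "zero_one_matrix M"
    and "level_eulerian M"
  shows "\<exists>\<Phi> \<in> nc_rational. ab_series M x y = nc_subst cd_to_ab \<Phi>"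
proof -
  note M = assms(1) and \<sigma> = cd_to_ab_constant_coeff
  let ?t = "nc_var Va - nc_var Vb" and ?c = "nc_var Va + nc_var Vb"
  let ?s = "(nc_var Vc)\<^sup>2 - nc_const 2 * nc_var Vd"
  let ?r = "\<lambda>v. nc_eval (reach_fps_even M x v) ?s"
  let ?A = "\<lambda>u v. nc_const (1/2) *
    (nc_var Vc * nc_eval (reach_fps_even M u v) ?s - ?s * nc_eval (reach_fps_odd M u v) ?s)"
  let ?r' = "\<lambda>v. nc_eval (reach_fps_even M x v) (?t\<^sup>2)"
  let ?A' = "\<lambda>u v. nc_const (1/2) *
    (?c * nc_eval (reach_fps_even M u v) (?t\<^sup>2) - ?t\<^sup>2 * nc_eval (reach_fps_odd M u v) (?t\<^sup>2))"
  have s: "?s \<in> nc_rational"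
    by (intro nc_rational_diff nc_rational_power nc_rational.mult nc_rational_const nc_rational_var)
  have s0: "nc_coeff ?s [] = 0"
    by (simp add: power2_eq_square nc_coeff_mult[of "nc_var _"] nc_coeff_var)
  have "\<exists>X. \<forall>v\<in>UNIV. X v \<in> nc_rational \<and> X v = ?r v + (\<Sum>u\<in>UNIV. X u * ?A u v)"
  proof (rule nc_rational_linear_system)
    show "nc_coeff (?A u v) [] = 0" for u v
      using s0 by (simp add: nc_coeff_mult[of "nc_var _"] nc_coeff_mult[of ?s] nc_coeff_var)
    show "?A u v \<in> nc_rational" for u v
      by (intro nc_rational.mult nc_rational_diff nc_rational_const nc_rational_var s
          nc_rational_eval_reach[OF M s s0])
  qed (simp_all only: finite nc_rational_eval_reach[OF M s s0])
  then obtain X where X: "\<And>v. X v \<in> nc_rational" "\<And>v. X v = ?r v + (\<Sum>u\<in>UNIV. X u * ?A u v)"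
    by blast
  \<comment> \<open>Substitution is a ring homomorphism that commutes with evaluation, so the image
    of the rational solution satisfies the system of the ab-series.\<close>
  have subst_X: "nc_subst cd_to_ab (X v) = ?r' v + (\<Sum>u\<in>UNIV. nc_subst cd_to_ab (X u) * ?A' u v)" for v
    by (subst X(2))
      (simp only: nc_subst_add nc_subst_sum nc_subst_mult[OF \<sigma>] nc_subst_diff[of _ "_ * _" "_ * nc_eval _ _"]
        nc_subst_const nc_subst_var[OF \<sigma>] nc_subst_eval[OF \<sigma> s0] a_minus_b_square cd_to_ab.simps)
  have ab: "ab_series M x v = ?r' v + (\<Sum>u\<in>UNIV. ab_series M x u * ?A' u v)" for v
    by (rule ab_series_cd_linear_system[OF assms])
  \<comment> \<open>The factors c and t^2 make the system proper, as uniqueness requires.\<close>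
  have A'0: "nc_coeff (?A' u v) [] = 0" for u v
    by (simp add: nc_coeff_mult nc_coeff_var power2_eq_square)
  have "ab_series M x y = nc_subst cd_to_ab (X y)"
    by (rule nc_linear_system_unique[where S = UNIV and A = ?A' and r = ?r'
          and X = "ab_series M x" and Y = "\<lambda>v. nc_subst cd_to_ab (X v)",
          OF A'0 ab subst_X UNIV_I])
  then show ?thesis using X(1) by blast
qed

end
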